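(* Let $K$ be a field. For every $a\ge1$, $b\ge2$ and $n\ge1$, the graph $G_{a,b,n}=\overline{K}_a\nabla(nB_b)$ is not Cohen–Macaulay; that is, the ring $R_{G_{a,b,n}}/I(G_{a,b,n})$ is not Cohen–Macaulay.
   Context: All graphs are finite, simple and undirected. For $b\ge 2$, $B_b$ is the graph with vertices $x_1,\dots,x_b,y_1,\dots,y_b$ and edges $\{x_i,x_j\}$ and $\{y_i,y_j\}$ for $1\le i<j\le b$, and $\{x_i,y_i\}$ for $1\le i\le b$. $nB_b$ is the disjoint union of $n$ copies of $B_b$. The join $G\nabla H$ of graphs on disjoint vertex sets is obtained from the disjoint union by adding every edge between $V(G)$ and $V(H)$. $\overline{K}_a$ is the edgeless graph on $a$ vertices. For a graph $G$, $R_G$ is the polynomial ring over $K$ whose variables are the vertices of $G$, and $I(G)=(xy:\{x,y\}\in E(G))\subseteq R_G$ is the edge ideal. $G$ is called Cohen–Macaulay if $R_G/I(G)$ is a Cohen–Macaulay ring. *)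

theory Defs
  imports
    "HOL-Library.Poly_Mapping"
    "HOL-Library.Extended_Nat"
    "HOL-Algebra.Algebra"
    "HOL-Algebra.Algebraic_Closure_Type"
begin

record 'v ugraph =
  verts :: "'v set"
  edges :: "'v set set"

definition simple_graph :: "'v ugraph \<Rightarrow> bool" where
  "simple_graph G \<longleftrightarrow> finite (verts G) \<and> (\<forall>e \<in> edges G. e \<subseteq> verts G \<and> card e = 2)"

definition edgeless_graph :: "nat \<Rightarrow> nat ugraph" where
  "edgeless_graph a = \<lparr>verts = {1..a}, edges = {}\<rparr>"

datatype bvertex = BX nat | BY nat

definition B_graph :: "nat \<Rightarrow> bvertex ugraph" where
  "B_graph b = \<lparr>verts = BX ` {1..b} \<union> BY ` {1..b},
     edges = {{BX i, BX j} | i j. 1 \<le> i \<and> i < j \<and> j \<le> b}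
           \<union> {{BY i, BY j} | i j. 1 \<le> i \<and> i < j \<and> j \<le> b}
           \<union> {{BX i, BY i} | i. 1 \<le> i \<and> i \<le> b}\<rparr>"

definition disjoint_copies :: "nat \<Rightarrow> 'v ugraph \<Rightarrow> (nat \<times> 'v) ugraph" where
  "disjoint_copies n G = \<lparr>verts = {1..n} \<times> verts G,
     edges = {Pair k ` e | k e. k \<in> {1..n} \<and> e \<in> edges G}\<rparr>"

text \<open>The sum type makes the two vertex sets disjoint.\<close>

definition graph_join :: "'v ugraph \<Rightarrow> 'w ugraph \<Rightarrow> ('v + 'w) ugraph" where
  "graph_join G H = \<lparr>verts = Inl ` verts G \<union> Inr ` verts H,
     edges = (`) Inl ` edges G \<union> (`) Inr ` edges H
           \<union> {{Inl x, Inr y} | x y. x \<in> verts G \<and> y \<in> verts H}\<rparr>"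

lemma simple_edgeless_graph: "simple_graph (edgeless_graph a)"
  by (simp add: simple_graph_def edgeless_graph_def)

lemma simple_B_graph: "simple_graph (B_graph b)"
  unfolding simple_graph_def B_graph_def by (auto simp: card_2_iff')

lemma simple_disjoint_copies:
  assumes "simple_graph G"
  shows "simple_graph (disjoint_copies n G)"
  using assms unfolding simple_graph_def disjoint_copies_def
  by (fastforce simp: card_image inj_on_def)

lemma simple_graph_join:
  assumes "simple_graph G" "simple_graph H"
  shows "simple_graph (graph_join G H)"
  using assms unfolding simple_graph_def graph_join_def
  by (fastforce simp: card_image)

definition loc_rel :: "('a, 'm) ring_scheme \<Rightarrow> 'a set \<Rightarrow> (('a \<times> 'a) \<times> ('a \<times> 'a)) set" where
  "loc_rel A S = {((a, s), (b, t)). a \<in> carrier A \<and> s \<in> S \<and> b \<in> carrier A \<and> t \<in> S \<and>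
     (\<exists>u\<in>S. u \<otimes>\<^bsub>A\<^esub> (t \<otimes>\<^bsub>A\<^esub> a) = u \<otimes>\<^bsub>A\<^esub> (s \<otimes>\<^bsub>A\<^esub> b))}"

definition loc_frac :: "('a, 'm) ring_scheme \<Rightarrow> 'a set \<Rightarrow> 'a \<Rightarrow> 'a \<Rightarrow> ('a \<times> 'a) set" where
  "loc_frac A S a s = loc_rel A S `` {(a, s)}"

definition localization :: "('a, 'm) ring_scheme \<Rightarrow> 'a set \<Rightarrow> ('a \<times> 'a) set ring" where
  "localization A S = \<lparr>
     carrier = (carrier A \<times> S) // loc_rel A S,
     monoid.mult = (\<lambda>P Q. \<Union>(a, s)\<in>P. \<Union>(b, t)\<in>Q. loc_frac A S (a \<otimes>\<^bsub>A\<^esub> b) (s \<otimes>\<^bsub>A\<^esub> t)),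
     one = loc_frac A S \<one>\<^bsub>A\<^esub> \<one>\<^bsub>A\<^esub>,
     ring.zero = loc_frac A S \<zero>\<^bsub>A\<^esub> \<one>\<^bsub>A\<^esub>,
     add = (\<lambda>P Q. \<Union>(a, s)\<in>P. \<Union>(b, t)\<in>Q.
              loc_frac A S (t \<otimes>\<^bsub>A\<^esub> a \<oplus>\<^bsub>A\<^esub> s \<otimes>\<^bsub>A\<^esub> b) (s \<otimes>\<^bsub>A\<^esub> t))\<rparr>"

definition localization_at :: "('a, 'm) ring_scheme \<Rightarrow> 'a set \<Rightarrow> ('a \<times> 'a) set ring" where
  "localization_at A p = localization A (carrier A - p)"

locale loc_setup = cring A for A (structure) +
  fixes S
  assumes S_submonoid: "submonoid S A"
begin

lemma S_carrier: "s \<in> S \<Longrightarrow> s \<in> carrier A"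
  using S_submonoid by (meson submonoid.mem_carrier)

lemma S_mult: "s \<in> S \<Longrightarrow> t \<in> S \<Longrightarrow> s \<otimes> t \<in> S"
  using S_submonoid by (meson submonoid.m_closed)

lemma S_one: "\<one> \<in> S"
  using S_submonoid by (meson submonoid.one_closed)

lemma equiv_loc_rel: "equiv (carrier A \<times> S) (loc_rel A S)"
proof (rule equivI)
  show "loc_rel A S \<subseteq> (carrier A \<times> S) \<times> (carrier A \<times> S)"
    by (auto simp: loc_rel_def)
  show "refl_on (carrier A \<times> S) (loc_rel A S)"
    using S_one by (auto simp: refl_on_def loc_rel_def)
  show "sym (loc_rel A S)"
    by (auto simp: sym_def loc_rel_def) metis
  show "trans (loc_rel A S)"
  proof (rule transI, clarify)
    fix a s b t c r
    assume "((a, s), (b, t)) \<in> loc_rel A S" "((b, t), (c, r)) \<in> loc_rel A S"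
    then obtain u v where C: "a \<in> carrier A" "b \<in> carrier A" "c \<in> carrier A"
        "s \<in> S" "t \<in> S" "r \<in> S" "u \<in> S" "v \<in> S"
      and E: "u \<otimes> (t \<otimes> a) = u \<otimes> (s \<otimes> b)" "v \<otimes> (r \<otimes> b) = v \<otimes> (t \<otimes> c)"
      by (auto simp: loc_rel_def)
    note D = C(1-3) C(4-8)[THEN S_carrier]
    have "(u \<otimes> v \<otimes> t) \<otimes> (r \<otimes> a) = v \<otimes> r \<otimes> (u \<otimes> (t \<otimes> a))"
      using D by (simp add: m_ac)
    also have "\<dots> = u \<otimes> s \<otimes> (v \<otimes> (r \<otimes> b))"
      unfolding E(1) using D by (simp add: m_ac)
    also have "\<dots> = (u \<otimes> v \<otimes> t) \<otimes> (s \<otimes> c)"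
      unfolding E(2) using D by (simp add: m_ac)
    finally show "((a, s), (c, r)) \<in> loc_rel A S"
      using C by (auto simp: loc_rel_def intro!: bexI[of _ "u \<otimes> v \<otimes> t"] S_mult)
  qed
qed

lemma loc_frac_eq_iff:
  assumes "a \<in> carrier A" "s \<in> S" "b \<in> carrier A" "t \<in> S"
  shows "loc_frac A S a s = loc_frac A S b t \<longleftrightarrow> (\<exists>u\<in>S. u \<otimes> (t \<otimes> a) = u \<otimes> (s \<otimes> b))"
proof -
  have "loc_frac A S a s = loc_frac A S b t \<longleftrightarrow> ((a, s), (b, t)) \<in> loc_rel A S"
    unfolding loc_frac_def using assms by (intro eq_equiv_class_iff[OF equiv_loc_rel]) auto
  then show ?thesis
    using assms by (simp add: loc_rel_def)
qed

lemma loc_frac_eqI: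
  assumes "a \<in> carrier A" "s \<in> S" "b \<in> carrier A" "t \<in> S" "t \<otimes> a = s \<otimes> b"
  shows "loc_frac A S a s = loc_frac A S b t"
  using assms S_one by (subst loc_frac_eq_iff) auto

lemma carrier_localization:
  "carrier (localization A S) = {loc_frac A S a s | a s. a \<in> carrier A \<and> s \<in> S}"
  by (auto simp: localization_def loc_frac_def quotient_def)

lemma loc_frac_closed [intro]:
  "a \<in> carrier A \<Longrightarrow> s \<in> S \<Longrightarrow> loc_frac A S a s \<in> carrier (localization A S)"
  by (auto simp: carrier_localization)

lemma loc_frac_mult:
  assumes "a \<in> carrier A" "s \<in> S" "b \<in> carrier A" "t \<in> S"
  shows "loc_frac A S a s \<otimes>\<^bsub>localization A S\<^esub> loc_frac A S b t = loc_frac A S (a \<otimes> b) (s \<otimes> t)"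
proof -
  have "congruent2 (loc_rel A S) (loc_rel A S)
          (\<lambda>p q. case p of (a, s) \<Rightarrow> case q of (b, t) \<Rightarrow> loc_frac A S (a \<otimes> b) (s \<otimes> t))"
  proof (rule congruent2I')
    fix p q p' q'
    assume "(p, p') \<in> loc_rel A S" "(q, q') \<in> loc_rel A S"
    then obtain a s a' s' b t b' t' u v where
      P: "p = (a, s)" "p' = (a', s')" "q = (b, t)" "q' = (b', t')" and
      C: "a \<in> carrier A" "a' \<in> carrier A" "b \<in> carrier A" "b' \<in> carrier A"
         "s \<in> S" "s' \<in> S" "t \<in> S" "t' \<in> S" "u \<in> S" "v \<in> S" and
      E: "u \<otimes> (s' \<otimes> a) = u \<otimes> (s \<otimes> a')" "v \<otimes> (t' \<otimes> b) = v \<otimes> (t \<otimes> b')"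
      by (auto simp: loc_rel_def)
    note D = C(1-4) C(5-10)[THEN S_carrier]
    have "(u \<otimes> v) \<otimes> ((s' \<otimes> t') \<otimes> (a \<otimes> b)) = (u \<otimes> (s' \<otimes> a)) \<otimes> (v \<otimes> (t' \<otimes> b))"
      using D by (simp add: m_ac)
    also have "\<dots> = (u \<otimes> v) \<otimes> ((s \<otimes> t) \<otimes> (a' \<otimes> b'))"
      unfolding E using D by (simp add: m_ac)
    finally show "(case p of (a, s) \<Rightarrow> case q of (b, t) \<Rightarrow> loc_frac A S (a \<otimes> b) (s \<otimes> t)) =
        (case p' of (a, s) \<Rightarrow> case q' of (b, t) \<Rightarrow> loc_frac A S (a \<otimes> b) (s \<otimes> t))"
      unfolding P prod.case using C D
      by (subst loc_frac_eq_iff) (auto intro!: S_mult bexI[of _ "u \<otimes> v"])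
  qed
  from UN_equiv_class2[OF equiv_loc_rel equiv_loc_rel this, of "(a, s)" "(b, t)"] assms
  show ?thesis
    by (simp add: localization_def loc_frac_def case_prod_unfold)
qed

lemma loc_frac_add:
  assumes "a \<in> carrier A" "s \<in> S" "b \<in> carrier A" "t \<in> S"
  shows "loc_frac A S a s \<oplus>\<^bsub>localization A S\<^esub> loc_frac A S b t
           = loc_frac A S (t \<otimes> a \<oplus> s \<otimes> b) (s \<otimes> t)"
proof -
  have "congruent2 (loc_rel A S) (loc_rel A S)
     (\<lambda>p q. case p of (a, s) \<Rightarrow> case q of (b, t) \<Rightarrow> loc_frac A S (t \<otimes> a \<oplus> s \<otimes> b) (s \<otimes> t))"
  proof (rule congruent2I')
    fix p q p' q'
    assume "(p, p') \<in> loc_rel A S" "(q, q') \<in> loc_rel A S"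
    then obtain a s a' s' b t b' t' u v where
      P: "p = (a, s)" "p' = (a', s')" "q = (b, t)" "q' = (b', t')" and
      C: "a \<in> carrier A" "a' \<in> carrier A" "b \<in> carrier A" "b' \<in> carrier A"
         "s \<in> S" "s' \<in> S" "t \<in> S" "t' \<in> S" "u \<in> S" "v \<in> S" and
      E: "u \<otimes> (s' \<otimes> a) = u \<otimes> (s \<otimes> a')" "v \<otimes> (t' \<otimes> b) = v \<otimes> (t \<otimes> b')"
      by (auto simp: loc_rel_def)
    note D = C(1-4) C(5-10)[THEN S_carrier]
    have "(u \<otimes> v) \<otimes> ((s' \<otimes> t') \<otimes> (t \<otimes> a \<oplus> s \<otimes> b))
        = (v \<otimes> t \<otimes> t') \<otimes> (u \<otimes> (s' \<otimes> a)) \<oplus> (u \<otimes> s \<otimes> s') \<otimes> (v \<otimes> (t' \<otimes> b))"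
      using D by (simp add: m_ac r_distr)
    also have "\<dots> = (u \<otimes> v) \<otimes> ((s \<otimes> t) \<otimes> (t' \<otimes> a' \<oplus> s' \<otimes> b'))"
      unfolding E using D by (simp add: m_ac r_distr)
    finally show "(case p of (a, s) \<Rightarrow> case q of (b, t) \<Rightarrow> loc_frac A S (t \<otimes> a \<oplus> s \<otimes> b) (s \<otimes> t)) =
        (case p' of (a, s) \<Rightarrow> case q' of (b, t) \<Rightarrow> loc_frac A S (t \<otimes> a \<oplus> s \<otimes> b) (s \<otimes> t))"
      unfolding P prod.case using C D
      by (subst loc_frac_eq_iff) (auto intro!: S_mult bexI[of _ "u \<otimes> v"])
  qed
  from UN_equiv_class2[OF equiv_loc_rel equiv_loc_rel this, of "(a, s)" "(b, t)"] assms
  show ?thesis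
    by (simp add: localization_def loc_frac_def case_prod_unfold)
qed

lemma zero_localization: "\<zero>\<^bsub>localization A S\<^esub> = loc_frac A S \<zero> \<one>"
  by (simp add: localization_def)

lemma one_localization: "\<one>\<^bsub>localization A S\<^esub> = loc_frac A S \<one> \<one>"
  by (simp add: localization_def)

lemma cring_localization: "cring (localization A S)"
proof (rule cringI)
  let ?L = "localization A S"
  have E: "\<exists>a s. P = loc_frac A S a s \<and> a \<in> carrier A \<and> s \<in> S" if "P \<in> carrier ?L" for P
    using that by (simp add: carrier_localization)
  note [simp] = loc_frac_add loc_frac_mult zero_localization one_localization S_one S_mult S_carrier
    loc_frac_closed
  show "abelian_group ?L"
  proof (rule abelian_groupI)
    fix P Q R assume "P \<in> carrier ?L" "Q \<in> carrier ?L" "R \<in> carrier ?L"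
    then obtain a s b t c r where
      P: "P = loc_frac A S a s" "a \<in> carrier A" "s \<in> S" and
      Q: "Q = loc_frac A S b t" "b \<in> carrier A" "t \<in> S" and
      R: "R = loc_frac A S c r" "c \<in> carrier A" "r \<in> S"
      using E by metis
    show "P \<oplus>\<^bsub>?L\<^esub> Q \<in> carrier ?L"
      using P Q by simp
    show "P \<oplus>\<^bsub>?L\<^esub> Q = Q \<oplus>\<^bsub>?L\<^esub> P"
      using P Q by (simp add: m_comm a_comm)
    show "P \<oplus>\<^bsub>?L\<^esub> Q \<oplus>\<^bsub>?L\<^esub> R = P \<oplus>\<^bsub>?L\<^esub> (Q \<oplus>\<^bsub>?L\<^esub> R)"
      using P Q R by (simp add: r_distr m_ac a_ac)
  next
    show "\<zero>\<^bsub>?L\<^esub> \<in> carrier ?L" by simp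
  next
    fix P assume "P \<in> carrier ?L"
    then obtain a s where P: "P = loc_frac A S a s" "a \<in> carrier A" "s \<in> S"
      using E by metis
    show "\<zero>\<^bsub>?L\<^esub> \<oplus>\<^bsub>?L\<^esub> P = P"
      using P by simp
    have "loc_frac A S (\<ominus> a) s \<oplus>\<^bsub>?L\<^esub> P = \<zero>\<^bsub>?L\<^esub>"
      using P by (simp add: r_minus l_neg) (rule loc_frac_eqI, auto)
    moreover have "loc_frac A S (\<ominus> a) s \<in> carrier ?L"
      using P by simp
    ultimately show "\<exists>Q\<in>carrier ?L. Q \<oplus>\<^bsub>?L\<^esub> P = \<zero>\<^bsub>?L\<^esub>" ..
  qed
  show "Group.comm_monoid ?L"
  proof (rule comm_monoidI)
    fix P Q R assume "P \<in> carrier ?L" "Q \<in> carrier ?L" "R \<in> carrier ?L"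
    then obtain a s b t c r where
      P: "P = loc_frac A S a s" "a \<in> carrier A" "s \<in> S" and
      Q: "Q = loc_frac A S b t" "b \<in> carrier A" "t \<in> S" and
      R: "R = loc_frac A S c r" "c \<in> carrier A" "r \<in> S"
      using E by metis
    show "P \<otimes>\<^bsub>?L\<^esub> Q \<in> carrier ?L"
      using P Q by simp
    show "P \<otimes>\<^bsub>?L\<^esub> Q = Q \<otimes>\<^bsub>?L\<^esub> P"
      using P Q by (simp add: m_comm)
    show "P \<otimes>\<^bsub>?L\<^esub> Q \<otimes>\<^bsub>?L\<^esub> R = P \<otimes>\<^bsub>?L\<^esub> (Q \<otimes>\<^bsub>?L\<^esub> R)"
      using P Q R by (simp add: m_assoc)
    show "\<one>\<^bsub>?L\<^esub> \<otimes>\<^bsub>?L\<^esub> P = P"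
      using P by simp
  qed simp
  fix P Q R assume "P \<in> carrier ?L" "Q \<in> carrier ?L" "R \<in> carrier ?L"
  then obtain a s b t c r where
    P: "P = loc_frac A S a s" "a \<in> carrier A" "s \<in> S" and
    Q: "Q = loc_frac A S b t" "b \<in> carrier A" "t \<in> S" and
    R: "R = loc_frac A S c r" "c \<in> carrier A" "r \<in> S"
    using E by metis
  show "(P \<oplus>\<^bsub>?L\<^esub> Q) \<otimes>\<^bsub>?L\<^esub> R = P \<otimes>\<^bsub>?L\<^esub> R \<oplus>\<^bsub>?L\<^esub> Q \<otimes>\<^bsub>?L\<^esub> R"
    using P Q R by simp (rule loc_frac_eqI, auto simp: r_distr l_distr m_ac)
qed

end

lemma loc_setup_compl_prime:
  assumes "primeideal p A"
  shows "loc_setup A (carrier A - p)"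
proof -
  interpret p: primeideal p A by fact
  have "\<one>\<^bsub>A\<^esub> \<notin> p" using p.one_imp_carrier p.I_notcarr by auto
  then have "submonoid (carrier A - p) A"
    by unfold_locales (auto dest: p.I_prime)
  then show ?thesis
    by (simp add: loc_setup_def loc_setup_axioms_def p.is_cring)
qed

lemma cring_localization_at:
  assumes "primeideal p A"
  shows "cring (localization_at A p)"
  unfolding localization_at_def
  using loc_setup_compl_prime[OF assms] by (rule loc_setup.cring_localization)

text \<open>The localization at a prime ideal is a local ring, so \<open>THE\<close> in \<open>depth\<close> below is well-defined.\<close>

lemma ex1_maximalideal_localization_at:
  fixes A (structure)
  assumes "primeideal p A"
  shows "\<exists>!m. maximalideal m (localization_at A p)"
proof -
  define S where "S = carrier A - p"
  interpret loc_setup A S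
    unfolding S_def by (rule loc_setup_compl_prime) fact
  interpret p: primeideal p A by fact
  define L where "L = localization A S"
  interpret L: cring L unfolding L_def by (rule cring_localization)
  define M where "M = {loc_frac A S a s | a s. a \<in> p \<and> s \<in> S}"
  have pc: "a \<in> carrier A" if "a \<in> p" for a using that by (rule p.a_Hcarr)
  have MI: "loc_frac A S a s \<in> M" if "a \<in> p" "s \<in> S" for a s
    using that by (auto simp: M_def)
  have mem_M: "a \<in> p" if C: "a \<in> carrier A" "s \<in> S" and M: "loc_frac A S a s \<in> M" for a s
  proof -
    obtain b t u where b: "b \<in> p" "t \<in> S" "u \<in> S" "u \<otimes> (t \<otimes> a) = u \<otimes> (s \<otimes> b)"
      using M C by (auto simp: M_def loc_frac_eq_iff pc)
    have "u \<otimes> (s \<otimes> b) \<in> p"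
      using b C by (intro p.I_l_closed) (auto intro: S_carrier)
    then have "(u \<otimes> t) \<otimes> a \<in> p"
      using b C by (simp add: m_assoc S_carrier)
    then have "u \<otimes> t \<in> p \<or> a \<in> p"
      using b C by (intro p.I_prime) (auto intro: S_carrier)
    then show ?thesis
      using S_mult[OF b(3,2)] by (simp add: S_def)
  qed
  have unit: "loc_frac A S a s \<in> Units L" if C: "a \<in> carrier A" "s \<in> S" "a \<notin> p" for a s
  proof -
    have a: "a \<in> S" using C by (simp add: S_def)
    have cl: "loc_frac A S a s \<in> carrier L" "loc_frac A S s a \<in> carrier L"
      using C a S_carrier[OF C(2)] by (auto simp: L_def)
    have "loc_frac A S a s \<otimes>\<^bsub>L\<^esub> loc_frac A S s a = \<one>\<^bsub>L\<^esub>"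
      using C a S_carrier[OF C(2)]
      by (simp add: L_def loc_frac_mult one_localization m_comm)
        (rule loc_frac_eqI, auto intro: S_mult S_one)
    then show ?thesis
      using cl L.m_comm[OF cl] unfolding Units_def by auto
  qed
  have idM: "ideal M L"
  proof (rule idealI)
    show "ring L" by (rule L.ring_axioms)
    show "subgroup M (add_monoid L)"
    proof (rule L.add.subgroupI)
      show "M \<subseteq> carrier L" by (auto simp: M_def L_def pc)
      have "loc_frac A S \<zero> \<one> \<in> M" by (rule MI[OF additive_subgroup.zero_closed[OF p.is_additive_subgroup] S_one])
      then show "M \<noteq> {}" by blast
    next
      fix x assume "x \<in> M"
      then obtain a s where x: "x = loc_frac A S a s" "a \<in> p" "s \<in> S" by (auto simp: M_def)
      note C = pc[OF x(2)] S_carrier[OF x(3)]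
      have "loc_frac A S (\<ominus> a) s \<oplus>\<^bsub>L\<^esub> x = \<zero>\<^bsub>L\<^esub>"
        using x C by (simp add: L_def loc_frac_add zero_localization r_minus l_neg)
          (rule loc_frac_eqI, auto intro: S_mult S_one)
      then have "\<ominus>\<^bsub>L\<^esub> x = loc_frac A S (\<ominus> a) s"
        using x C by (intro L.minus_equality) (simp_all add: L_def loc_frac_closed)
      then show "\<ominus>\<^bsub>L\<^esub> x \<in> M"
        using MI[OF additive_subgroup.a_inv_closed[OF p.is_additive_subgroup x(2)] x(3)] by simp
    next
      fix x y assume "x \<in> M" "y \<in> M"
      then obtain a s b t where x: "x = loc_frac A S a s" "a \<in> p" "s \<in> S"
        "y = loc_frac A S b t" "b \<in> p" "t \<in> S" by (auto simp: M_def)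
      have "t \<otimes> a \<oplus> s \<otimes> b \<in> p"
        using x by (intro additive_subgroup.a_closed[OF p.is_additive_subgroup] p.I_l_closed)
          (simp_all add: S_carrier)
      then show "x \<oplus>\<^bsub>L\<^esub> y \<in> M"
        using x by (simp add: L_def loc_frac_add pc MI S_mult)
    qed
  next
    fix x r assume "x \<in> M" "r \<in> carrier L"
    then obtain a s b t where x: "x = loc_frac A S a s" "a \<in> p" "s \<in> S"
      "r = loc_frac A S b t" "b \<in> carrier A" "t \<in> S"
      by (auto simp: M_def L_def carrier_localization)
    have "b \<otimes> a \<in> p" using x by (intro p.I_l_closed)
    then show rx: "r \<otimes>\<^bsub>L\<^esub> x \<in> M"
      using x by (simp add: L_def loc_frac_mult pc MI S_mult)
    have "x \<otimes>\<^bsub>L\<^esub> r = r \<otimes>\<^bsub>L\<^esub> x"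
      using x by (intro L.m_comm) (simp_all add: L_def pc loc_frac_closed)
    with rx show "x \<otimes>\<^bsub>L\<^esub> r \<in> M" by simp
  qed
  have "\<one> \<notin> p" using S_one by (simp add: S_def)
  then have one: "\<one>\<^bsub>L\<^esub> \<notin> M"
    using mem_M[of \<one> \<one>] S_one by (auto simp: L_def one_localization)
  have sub: "J \<subseteq> M" if J: "ideal J L" "J \<noteq> carrier L" for J
  proof
    interpret J: ideal J L by fact
    fix x assume x: "x \<in> J"
    then obtain a s where a: "x = loc_frac A S a s" "a \<in> carrier A" "s \<in> S"
      using J.a_Hcarr[OF x] by (auto simp: L_def carrier_localization)
    show "x \<in> M"
    proof (cases "a \<in> p")
      case True
      then show ?thesis using a by (simp add: MI)
    next
      case False
      then have "x \<in> Units L" using unit a by simp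
      then have "inv\<^bsub>L\<^esub> x \<otimes>\<^bsub>L\<^esub> x \<in> J" using x by (intro J.I_l_closed) auto
      then have "\<one>\<^bsub>L\<^esub> \<in> J" using \<open>x \<in> Units L\<close> by simp
      then show ?thesis using J J.one_imp_carrier by simp
    qed
  qed
  have "M \<noteq> carrier L" using one by auto
  have "maximalideal M L"
  proof (rule maximalidealI)
    show "carrier L \<noteq> M" using \<open>M \<noteq> carrier L\<close> by simp
    show "J = M \<or> J = carrier L" if "ideal J L" "M \<subseteq> J" "J \<subseteq> carrier L" for J
      using sub[of J] that by blast
  qed (rule idM)
  moreover have "m = M" if "maximalideal m L" for m
  proof -
    interpret m: maximalideal m L by fact
    show ?thesis
      using sub[OF m.is_ideal] m.I_notcarr m.I_maximal[OF idM]
        ideal.Icarr[OF idM] \<open>M \<noteq> carrier L\<close> by blast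
  qed
  ultimately show ?thesis
    unfolding localization_at_def L_def S_def by blast
qed

text \<open>The implication says that \<open>xs ! i\<close> is a nonzerodivisor on the quotient of \<open>A\<close> by
  the ideal generated by the preceding elements.\<close>

definition regular_sequence :: "('a, 'm) ring_scheme \<Rightarrow> 'a list \<Rightarrow> bool" where
  "regular_sequence A xs \<longleftrightarrow> set xs \<subseteq> carrier A \<and>
     (\<forall>i < length xs. \<forall>r \<in> carrier A.
        xs ! i \<otimes>\<^bsub>A\<^esub> r \<in> Idl\<^bsub>A\<^esub> (set (take i xs)) \<longrightarrow> r \<in> Idl\<^bsub>A\<^esub> (set (take i xs))) \<and>
     Idl\<^bsub>A\<^esub> (set xs) \<noteq> carrier A"

text \<open>The depth of a Noetherian local ring; a junk value for rings that are not local.\<close>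

definition depth :: "('a, 'm) ring_scheme \<Rightarrow> enat" where
  "depth A = (SUP xs \<in> {xs. regular_sequence A xs \<and> set xs \<subseteq> (THE m. maximalideal m A)}.
     enat (length xs))"

definition krull_dim :: "('a, 'm) ring_scheme \<Rightarrow> enat" where
  "krull_dim A = (SUP n \<in> {n. \<exists>P. (\<forall>i\<le>n. primeideal (P i) A) \<and> (\<forall>i<n. P i \<subset> P (Suc i))}. enat n)"

definition cohen_macaulay_ring :: "('a, 'm) ring_scheme \<Rightarrow> bool" where
  "cohen_macaulay_ring A \<longleftrightarrow> cring A \<and> noetherian_ring A \<and>
     (\<forall>m. maximalideal m A \<longrightarrow> depth (localization_at A m) = krull_dim (localization_at A m))"

text \<open>The polynomial ring over \<open>'k\<close> in the variables \<open>V\<close>: a polynomial is a finitely supported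
  map from exponent vectors to coefficients.\<close>

definition mpoly_ring :: "'k::field itself \<Rightarrow> 'v set \<Rightarrow> (('v \<Rightarrow>\<^sub>0 nat) \<Rightarrow>\<^sub>0 'k) ring" where
  "mpoly_ring K V = ring_of_type_algebra
     \<lparr>carrier := {p. \<forall>m \<in> Poly_Mapping.keys p. Poly_Mapping.keys m \<subseteq> V}\<rparr>"

lemma cring_mpoly_ring:
  fixes K :: "'k::field itself" and V :: "'v set"
  shows "cring (mpoly_ring K V)"
proof -
  let ?R = "ring_of_type_algebra :: (('v \<Rightarrow>\<^sub>0 nat) \<Rightarrow>\<^sub>0 'k::field) ring"
  let ?C = "{p :: ('v \<Rightarrow>\<^sub>0 nat) \<Rightarrow>\<^sub>0 'k. \<forall>m \<in> Poly_Mapping.keys p. Poly_Mapping.keys m \<subseteq> V}"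
  interpret R: cring ?R by (rule cring_from_type_algebra)
  have neg: "\<ominus>\<^bsub>?R\<^esub> p = - p" for p
    by (rule R.minus_equality) (simp_all add: ring_of_type_algebra_def)
  have "subring ?C ?R"
  proof (rule R.subringI)
    fix p q assume pq: "p \<in> ?C" "q \<in> ?C"
    show "\<ominus>\<^bsub>?R\<^esub> p \<in> ?C"
      using pq by (simp add: neg)
    show "p \<oplus>\<^bsub>?R\<^esub> q \<in> ?C"
      using pq Poly_Mapping.keys_add[of p q] by (auto simp: ring_of_type_algebra_def)
    show "p \<otimes>\<^bsub>?R\<^esub> q \<in> ?C"
    proof -
      have "Poly_Mapping.keys m \<subseteq> V" if "m \<in> Poly_Mapping.keys (p * q)" for m
      proof -
        obtain u v where "m = u + v" "u \<in> Poly_Mapping.keys p" "v \<in> Poly_Mapping.keys q"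
          using \<open>m \<in> _\<close> keys_mult[of p q] by blast
        then show ?thesis
          using pq Poly_Mapping.keys_add[of u v] by blast
      qed
      then show ?thesis by (auto simp: ring_of_type_algebra_def)
    qed
  qed (auto simp: ring_of_type_algebra_def)
  then show ?thesis
    unfolding mpoly_ring_def
    using R.subcring_iff[of ?C] R.subcringI'[of ?C] by (simp add: ring_of_type_algebra_def)
qed

definition poly_var :: "'v \<Rightarrow> ('v \<Rightarrow>\<^sub>0 nat) \<Rightarrow>\<^sub>0 'k::field" where
  "poly_var v = Poly_Mapping.single (Poly_Mapping.single v 1) 1"

definition edge_ideal :: "'k::field itself \<Rightarrow> 'v ugraph \<Rightarrow> (('v \<Rightarrow>\<^sub>0 nat) \<Rightarrow>\<^sub>0 'k) set" where
  "edge_ideal K G = Idl\<^bsub>mpoly_ring K (verts G)\<^esub>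
     {poly_var x \<otimes>\<^bsub>mpoly_ring K (verts G)\<^esub> poly_var y | x y. {x, y} \<in> edges G}"

lemma ideal_edge_ideal:
  assumes "simple_graph G"
  shows "ideal (edge_ideal K G) (mpoly_ring K (verts G))"
proof -
  let ?R = "mpoly_ring K (verts G)"
  interpret R: cring ?R by (rule cring_mpoly_ring)
  have var: "poly_var x \<in> carrier ?R" if "x \<in> verts G" for x
    using that by (auto simp: mpoly_ring_def poly_var_def)
  have "x \<in> verts G \<and> y \<in> verts G" if "{x, y} \<in> edges G" for x y
    using assms that unfolding simple_graph_def by fastforce
  then show ?thesis
    unfolding edge_ideal_def by (intro R.genideal_ideal) (auto intro: var)
qed

definition cohen_macaulay_graph :: "'k::field itself \<Rightarrow> 'v ugraph \<Rightarrow> bool" where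
  "cohen_macaulay_graph K G \<longleftrightarrow> cohen_macaulay_ring (mpoly_ring K (verts G) Quot edge_ideal K G)"

end

theory Submission
  imports Defs
begin

text \<open>Products across \<open>J\<close> and \<open>K\<close> vanish, so for
  \<open>f = f1 + f2\<close> in the maximal ideal every element of that ideal multiplies
  \<open>f1\<close> into \<open>(f)\<close>. A second regular element would force \<open>f1\<close>
  into \<open>(f)\<close>; locality then gives \<open>f1 = 0\<close> or \<open>f2 = 0\<close>, and
  \<open>f\<close> is a zero divisor because both ideals are nonzero. The obstacle is that this
  happens in a localization of a quotient, while the combinatorics is visible only on monomials. The
  data are therefore given in the polynomial ring, by conditions on exponent vectors, and carried
  through both constructions. Localization could kill \<open>J\<close> or \<open>K\<close>; a
  variable from each factor, annihilated by nothing outside the maximal ideal, prevents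
  this.\<close>

text \<open>
  The independence complex of a join is the disjoint union of the two independence complexes.
  Algebraically, the irrelevant maximal ideal of the edge ring is \<open>J + K\<close> with \<open>J\<close> and \<open>K\<close> generated
  by the variables of the two factors and \<open>J \<inter> K = 0\<close>, so the local ring there has depth at
  most one. Its dimension is at least two as soon as one factor has two non-adjacent vertices,
  here \<open>x\<^sub>1\<close> and \<open>y\<^sub>2\<close> in the first copy of \<open>B_b\<close>. In particular it does not matter whether the
  complex is pure.
\<close>


subsection \<open>Local rings of depth at most one\<close>

text \<open>A proper ideal contains no unit and so lies in \<open>M\<close>. This evaluates the
  \<open>THE\<close> inside \<open>depth\<close>.\<close>

lemma (in cring) maximalideal_iff_eq_nonunits:
  assumes M: "ideal M R" "M \<noteq> carrier R" "carrier R - M \<subseteq> Units R"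
  shows "maximalideal m R \<longleftrightarrow> m = M"
proof -
  have sub: "J \<subseteq> M" if J: "ideal J R" "J \<noteq> carrier R" for J
  proof
    interpret J: ideal J R by fact
    fix x assume x: "x \<in> J"
    show "x \<in> M"
    proof (rule ccontr)
      assume "x \<notin> M"
      then have u: "x \<in> Units R" using M(3) J.Icarr[OF x] by blast
      then have "inv x \<otimes> x \<in> J" using x by (intro J.I_l_closed) auto
      then show False using u J.one_imp_carrier J(2) by simp
    qed
  qed
  have "maximalideal M R"
    using M sub by (intro maximalidealI) blast+
  moreover have "m = M" if "maximalideal m R"
  proof -
    interpret m: maximalideal m R by fact
    show ?thesis
      using sub[OF m.is_ideal] m.I_notcarr m.I_maximal[OF M(1)] M(2) ideal.Icarr[OF M(1)] by blast
  qed
  ultimately show ?thesis by blast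
qed

text \<open>Products of elements of \<open>J1\<close> and \<open>J2\<close> lie in the intersection
  and vanish. With \<open>g = g1 + g2\<close> the cross terms disappear, so
  \<open>g f1 = g1 f1 = g1 (f1 + f2)\<close>.\<close>

lemma (in cring) socle_split:
  assumes J: "ideal J1 R" "ideal J2 R" "J1 \<inter> J2 = {\<zero>}"
    and M: "M \<subseteq> J1 <+>\<^bsub>R\<^esub> J2" and g: "g \<in> M"
    and f: "f1 \<in> J1" "f2 \<in> J2"
  shows "g \<otimes> f1 \<in> PIdl (f1 \<oplus> f2)"
proof -
  interpret J1: ideal J1 R by fact
  interpret J2: ideal J2 R by fact
  obtain g1 g2 where g12: "g1 \<in> J1" "g2 \<in> J2" "g = g1 \<oplus> g2"
    using M g by (auto simp: set_add_def')
  note c = f(1)[THEN J1.Icarr] f(2)[THEN J2.Icarr] g12(1)[THEN J1.Icarr] g12(2)[THEN J2.Icarr]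
  have ann: "x \<otimes> y = \<zero>" if "x \<in> J1" "y \<in> J2" for x y
    using that J(3) J1.I_r_closed[of x y] J2.I_l_closed[of y x] J1.Icarr J2.Icarr by blast
  have "g2 \<otimes> f1 = \<zero>" "g1 \<otimes> f2 = \<zero>"
    using ann f g12 c by (simp_all add: m_comm[of g2])
  then have "g \<otimes> f1 = g1 \<otimes> (f1 \<oplus> f2)"
    using c by (simp add: g12 l_distr r_distr)
  then show ?thesis using c unfolding cgenideal_def by blast
qed

text \<open>If \<open>f = f1 + f2\<close> is regular, then the class of \<open>f1\<close> is a nonzero socle element modulo \<open>f\<close>,
  so a regular sequence cannot be continued after \<open>f\<close>.\<close>

lemma (in cring) depth_le_one_if_ideals_split:
  assumes M: "ideal M R" "M \<noteq> carrier R" "carrier R - M \<subseteq> Units R"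
    and J: "ideal J1 R" "ideal J2 R" "J1 \<inter> J2 = {\<zero>}" "J1 \<noteq> {\<zero>}" "J2 \<noteq> {\<zero>}" "M \<subseteq> J1 <+>\<^bsub>R\<^esub> J2"
  shows "depth R \<le> 1"
proof -
  interpret J1: ideal J1 R by fact
  interpret J2: ideal J2 R by fact
  interpret M: ideal M R by fact
  have the_M: "(THE m. maximalideal m R) = M"
    using maximalideal_iff_eq_nonunits[OF M] by simp
  have ann: "x \<otimes> y = \<zero>" if "x \<in> J1" "y \<in> J2" for x y
    using that J(3) J1.I_r_closed[of x y] J2.I_l_closed[of y x] J1.Icarr J2.Icarr by blast
  have "length xs \<le> 1" if reg: "regular_sequence R xs" and xs: "set xs \<subseteq> M" for xs
  proof (rule ccontr)
    assume "\<not> length xs \<le> 1"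
    then obtain f g ys where ys: "xs = f # g # ys"
      by (cases xs; cases "tl xs") auto
    have fg: "f \<in> M" "g \<in> M" using xs ys by auto
    note fgc = fg[THEN M.Icarr]
    \<comment> \<open>The first entry of a regular sequence is tested modulo the ideal generated by
      no elements; as this is zero, the test says that \<open>f\<close> is a nonzerodivisor.\<close>
    have "Idl {} = {\<zero>}"
    proof
      show "Idl {} \<subseteq> {\<zero>}" by (rule genideal_minimal[OF zeroideal]) simp
      show "{\<zero>} \<subseteq> Idl {}"
        using additive_subgroup.zero_closed[OF ideal.axioms(1)[OF genideal_ideal]] by simp
    qed
    moreover have "\<forall>r\<in>carrier R. xs ! 0 \<otimes> r \<in> Idl (set (take 0 xs)) \<longrightarrow> r \<in> Idl (set (take 0 xs))"
      using reg unfolding regular_sequence_def ys by (auto simp del: take_0)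
    ultimately have f_reg: "r = \<zero>" if "r \<in> carrier R" "f \<otimes> r = \<zero>" for r
      using that by (simp add: ys)
    have g_reg: "r \<in> PIdl f" if "r \<in> carrier R" "g \<otimes> r \<in> PIdl f" for r
    proof -
      have "\<forall>r\<in>carrier R. xs ! 1 \<otimes> r \<in> Idl (set (take 1 xs)) \<longrightarrow> r \<in> Idl (set (take 1 xs))"
        using reg unfolding regular_sequence_def ys by (auto simp del: take_Suc_Cons)
      then show ?thesis using that fgc unfolding ys by (simp add: cgenideal_eq_genideal)
    qed
    obtain f1 f2 where f12: "f1 \<in> J1" "f2 \<in> J2" "f = f1 \<oplus> f2"
      using J(6) fg by (auto simp: set_add_def')
    note c = f12(1)[THEN J1.Icarr] f12(2)[THEN J2.Icarr]
    \<comment> \<open>\<open>g\<close> multiplies \<open>f1\<close> into \<open>(f)\<close> and is a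
      nonzerodivisor modulo \<open>f\<close>, so \<open>f1\<close> itself lies in
      \<open>(f)\<close>.\<close>
    have "f1 \<in> PIdl f"
      using g_reg[OF c(1)] socle_split[OF J(1-3,6) fg(2) f12(1,2)] f12 by simp
    then obtain h where h: "h \<in> carrier R" "f1 = h \<otimes> f"
      unfolding cgenideal_def by blast
    have hc: "h \<otimes> f1 \<in> carrier R" "h \<otimes> f2 \<in> carrier R" using c h by auto
    have "f1 \<ominus> h \<otimes> f1 = (h \<otimes> f2 \<oplus> h \<otimes> f1) \<ominus> h \<otimes> f1"
      using h c f12(3) by (simp add: r_distr a_comm)
    then have e: "f1 \<ominus> h \<otimes> f1 = h \<otimes> f2"
      using hc by (simp add: a_minus_def a_assoc r_neg)
    have e': "f1 \<ominus> h \<otimes> f1 = (\<one> \<ominus> h) \<otimes> f1" using c h(1) by (simp add: a_minus_def l_distr l_minus)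
    \<comment> \<open>The equation \<open>(1 - h) f1 = h f2\<close> has its left side in
      \<open>J1\<close> and its right side in \<open>J2\<close>, so both sides lie in the zero
      intersection.\<close>
    have z: "(\<one> \<ominus> h) \<otimes> f1 = \<zero>" "h \<otimes> f2 = \<zero>"
    proof -
      have "(\<one> \<ominus> h) \<otimes> f1 \<in> J1" "h \<otimes> f2 \<in> J2"
        using f12 h(1) by (auto intro!: J1.I_l_closed J2.I_l_closed)
      then show "(\<one> \<ominus> h) \<otimes> f1 = \<zero>" "h \<otimes> f2 = \<zero>" using e e' J(3) by auto
    qed
    have U: "v = \<zero>" if "u \<in> Units R" "v \<in> carrier R" "u \<otimes> v = \<zero>" for u v
      using that Units_l_cancel[of u v \<zero>] Units_closed[of u] by simp
    \<comment> \<open>By locality one of the two is a unit, so \<open>f1\<close> or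
      \<open>f2\<close> vanishes. Then \<open>f\<close> lies in one of the two ideals and is killed
      by a nonzero element of the other.\<close>
    have "h \<in> Units R \<or> \<one> \<ominus> h \<in> Units R"
    proof (rule ccontr)
      assume "\<not> ?thesis"
      then have "h \<in> M" "\<one> \<ominus> h \<in> M" using M(3) h(1) minus_closed[of \<one> h] by blast+
      then have "(\<one> \<ominus> h) \<oplus> h \<in> M" by simp
      then have "\<one> \<in> M" using h(1) by (simp add: a_minus_def a_assoc l_neg)
      then show False using M.one_imp_carrier M(2) by blast
    qed
    then show False
    proof
      assume "h \<in> Units R"
      then have "f = f1" using U[OF _ c(2) z(2)] f12 c by simp
      moreover obtain y where "y \<in> J2" "y \<noteq> \<zero>" using J(5) J2.zero_closed by blast
      ultimately show False using f_reg[of y] ann[of f1 y] f12 J2.Icarr by blast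
    next
      assume "\<one> \<ominus> h \<in> Units R"
      then have "f = f2" using U[OF _ c(1) z(1)] f12 c by simp
      moreover obtain y where "y \<in> J1" "y \<noteq> \<zero>" using J(4) J1.zero_closed by blast
      ultimately show False using f_reg[of y] ann[of y f2] f12 J1.Icarr J2.Icarr m_comm by metis
    qed
  qed
  then show ?thesis
    unfolding depth_def the_M by (intro SUP_least) (auto simp: one_enat_def)
qed

subsection \<open>Ideals of a localization\<close>

context loc_setup
begin

text \<open>The extension of \<open>J\<close> to the localization. A fraction in it may also have
  representatives with numerator outside \<open>J\<close>.\<close>

definition loc_ideal where
  "loc_ideal J = {loc_frac A S a s | a s. a \<in> J \<and> s \<in> S}"

lemma ideal_loc_ideal:
  assumes "ideal J A"
  shows "ideal (loc_ideal J) (localization A S)"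
proof -
  interpret J: ideal J A by fact
  define L where "L = localization A S"
  interpret L: cring L unfolding L_def by (rule cring_localization)
  have MI: "loc_frac A S a s \<in> loc_ideal J" if "a \<in> J" "s \<in> S" for a s
    using that by (auto simp: loc_ideal_def)
  have "ideal (loc_ideal J) L"
  proof (rule idealI)
    show "ring L" by (rule L.ring_axioms)
    show "subgroup (loc_ideal J) (add_monoid L)"
    proof (rule L.add.subgroupI)
      show "loc_ideal J \<subseteq> carrier L" by (auto simp: loc_ideal_def L_def)
      show "loc_ideal J \<noteq> {}" using MI[OF J.zero_closed S_one] by blast
    next
      fix x assume "x \<in> loc_ideal J"
      then obtain a s where x: "x = loc_frac A S a s" "a \<in> J" "s \<in> S" by (auto simp: loc_ideal_def)
      note C = J.Icarr[OF x(2)] S_carrier[OF x(3)]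
      have "loc_frac A S (\<ominus> a) s \<oplus>\<^bsub>L\<^esub> x = \<zero>\<^bsub>L\<^esub>"
        using x C by (simp add: L_def loc_frac_add zero_localization r_minus l_neg)
          (rule loc_frac_eqI, auto intro: S_mult S_one)
      then have "\<ominus>\<^bsub>L\<^esub> x = loc_frac A S (\<ominus> a) s"
        using x C by (intro L.minus_equality) (simp_all add: L_def loc_frac_closed)
      then show "\<ominus>\<^bsub>L\<^esub> x \<in> loc_ideal J" using MI x J.a_inv_closed by simp
    next
      fix x y assume "x \<in> loc_ideal J" "y \<in> loc_ideal J"
      then obtain a s b t where x: "x = loc_frac A S a s" "a \<in> J" "s \<in> S"
        "y = loc_frac A S b t" "b \<in> J" "t \<in> S" by (auto simp: loc_ideal_def)
      have "t \<otimes> a \<oplus> s \<otimes> b \<in> J"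
        using x by (intro J.a_closed J.I_l_closed) (simp_all add: S_carrier)
      then show "x \<oplus>\<^bsub>L\<^esub> y \<in> loc_ideal J"
        using x by (simp add: L_def loc_frac_add MI S_mult)
    qed
  next
    fix x r assume "x \<in> loc_ideal J" "r \<in> carrier L"
    then obtain a s b t where x: "x = loc_frac A S a s" "a \<in> J" "s \<in> S"
      "r = loc_frac A S b t" "b \<in> carrier A" "t \<in> S"
      by (auto simp: loc_ideal_def L_def carrier_localization)
    show rx: "r \<otimes>\<^bsub>L\<^esub> x \<in> loc_ideal J"
      using x by (simp add: L_def loc_frac_mult MI S_mult J.I_l_closed)
    have "x \<otimes>\<^bsub>L\<^esub> r = r \<otimes>\<^bsub>L\<^esub> x"
      using x by (intro L.m_comm) (simp_all add: L_def loc_frac_closed)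
    with rx show "x \<otimes>\<^bsub>L\<^esub> r \<in> loc_ideal J" by simp
  qed
  then show ?thesis by (simp add: L_def)
qed

text \<open>Equality of fractions yields only that \<open>u t a\<close> lies in \<open>q\<close> for
  some \<open>u\<close> and \<open>t\<close> in \<open>S\<close>; primality and disjointness from
  \<open>S\<close> cancel the factor \<open>u t\<close>.\<close>

lemma loc_frac_in_loc_ideal_iff:
  assumes "primeideal q A" "q \<inter> S = {}" "a \<in> carrier A" "s \<in> S"
  shows "loc_frac A S a s \<in> loc_ideal q \<longleftrightarrow> a \<in> q"
proof
  interpret q: primeideal q A by fact
  assume "loc_frac A S a s \<in> loc_ideal q"
  then obtain b t u where b: "b \<in> q" "t \<in> S" "u \<in> S" "u \<otimes> (t \<otimes> a) = u \<otimes> (s \<otimes> b)"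
    using assms(3,4) by (auto simp: loc_ideal_def loc_frac_eq_iff)
  have "u \<otimes> (s \<otimes> b) \<in> q"
    using b assms by (intro q.I_l_closed) (auto intro: S_carrier)
  then have "(u \<otimes> t) \<otimes> a \<in> q"
    using b assms by (simp add: m_assoc S_carrier)
  then have "u \<otimes> t \<in> q \<or> a \<in> q"
    using b assms by (intro q.I_prime) (auto intro: S_carrier)
  then show "a \<in> q" using S_mult[OF b(3,2)] assms(2) by blast
qed (use assms in \<open>auto simp: loc_ideal_def\<close>)

lemma primeideal_loc_ideal:
  assumes q: "primeideal q A" "q \<inter> S = {}"
  shows "primeideal (loc_ideal q) (localization A S)"
proof (rule primeidealI)
  interpret q: primeideal q A by fact
  show "ideal (loc_ideal q) (localization A S)"
    by (rule ideal_loc_ideal) (rule q.is_ideal)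
  show "cring (localization A S)" by (rule cring_localization)
  have "loc_frac A S \<one> \<one> \<notin> loc_ideal q"
    using loc_frac_in_loc_ideal_iff[OF q, of \<one> \<one>] S_one q(2) by auto
  then show "carrier (localization A S) \<noteq> loc_ideal q"
    using loc_frac_closed S_one by blast
  fix x y assume "x \<in> carrier (localization A S)" "y \<in> carrier (localization A S)"
    and xy: "x \<otimes>\<^bsub>localization A S\<^esub> y \<in> loc_ideal q"
  then obtain a s b t where x: "x = loc_frac A S a s" "a \<in> carrier A" "s \<in> S"
      "y = loc_frac A S b t" "b \<in> carrier A" "t \<in> S"
    by (auto simp: carrier_localization)
  then show "x \<in> loc_ideal q \<or> y \<in> loc_ideal q"
    using xy q.I_prime by (simp add: loc_frac_mult loc_frac_in_loc_ideal_iff[OF q] S_mult)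
qed

lemma loc_ideal_mono_strict:
  assumes "primeideal p A" "p \<inter> S = {}" "primeideal q A" "q \<inter> S = {}" "p \<subset> q"
  shows "loc_ideal p \<subset> loc_ideal q"
proof -
  obtain x where "x \<in> q" "x \<notin> p" using assms(5) by blast
  moreover have "x \<in> carrier A" using \<open>x \<in> q\<close> ideal.Icarr[OF primeideal.axioms(1)[OF assms(3)]] by blast
  ultimately have "loc_frac A S x \<one> \<in> loc_ideal q - loc_ideal p"
    using assms S_one by (simp add: loc_frac_in_loc_ideal_iff)
  moreover have "loc_ideal p \<subseteq> loc_ideal q" using assms(5) by (auto simp: loc_ideal_def)
  ultimately show ?thesis by blast
qed

lemma loc_frac_in_Units:
  assumes "a \<in> S" "s \<in> S"
  shows "loc_frac A S a s \<in> Units (localization A S)"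
proof -
  interpret L: cring "localization A S" by (rule cring_localization)
  note C = assms assms[THEN S_carrier]
  have cl: "loc_frac A S a s \<in> carrier (localization A S)" "loc_frac A S s a \<in> carrier (localization A S)"
    using C by auto
  have "loc_frac A S a s \<otimes>\<^bsub>localization A S\<^esub> loc_frac A S s a = \<one>\<^bsub>localization A S\<^esub>"
    using C by (simp add: loc_frac_mult one_localization m_comm)
      (rule loc_frac_eqI, auto intro: S_mult S_one)
  then show ?thesis
    using cl L.m_comm[OF cl] unfolding Units_def by auto
qed

text \<open>If a fraction has one numerator in \<open>J\<close> and another in \<open>K\<close>,
  cross-multiplication produces an element \<open>u t a = u s b\<close> of both ideals, which serves
  as a common numerator.\<close>

lemma loc_ideal_Int:
  assumes "ideal J A" "ideal K A"
  shows "loc_ideal J \<inter> loc_ideal K = loc_ideal (J \<inter> K)"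
proof
  interpret J: ideal J A by fact
  interpret K: ideal K A by fact
  show "loc_ideal J \<inter> loc_ideal K \<subseteq> loc_ideal (J \<inter> K)"
  proof
    fix x assume "x \<in> loc_ideal J \<inter> loc_ideal K"
    then obtain a s b t where x: "x = loc_frac A S a s" "a \<in> J" "s \<in> S"
      "x = loc_frac A S b t" "b \<in> K" "t \<in> S" unfolding loc_ideal_def by blast
    have "loc_frac A S a s = loc_frac A S b t" using x(1,4) by simp
    then obtain u where u: "u \<in> S" "u \<otimes> (t \<otimes> a) = u \<otimes> (s \<otimes> b)"
      unfolding loc_frac_eq_iff[OF J.Icarr[OF x(2)] x(3) K.Icarr[OF x(5)] x(6)] by blast
    note C = J.Icarr[OF x(2)] u(1)[THEN S_carrier] x(3,6)[THEN S_carrier]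
    have "u \<otimes> (t \<otimes> a) \<in> J" using x C by (intro J.I_l_closed) auto
    moreover have "u \<otimes> (t \<otimes> a) \<in> K" unfolding u(2) using x C by (intro K.I_l_closed) auto
    moreover have "x = loc_frac A S (u \<otimes> (t \<otimes> a)) (u \<otimes> (t \<otimes> s))"
      unfolding x(1) using C x(3,6) u(1) by (intro loc_frac_eqI) (simp_all add: m_ac S_mult)
    moreover have "u \<otimes> (t \<otimes> s) \<in> S" using u(1) x(3,6) by (intro S_mult)
    ultimately show "x \<in> loc_ideal (J \<inter> K)" unfolding loc_ideal_def by blast
  qed
qed (auto simp: loc_ideal_def)

lemma loc_ideal_zero: "loc_ideal {\<zero>} = {\<zero>\<^bsub>localization A S\<^esub>}"
proof -
  have "loc_frac A S \<zero> s = loc_frac A S \<zero> \<one>" if "s \<in> S" for s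
    using that S_one S_carrier by (intro loc_frac_eqI) auto
  then show ?thesis
    using S_one unfolding loc_ideal_def zero_localization by blast
qed

lemma loc_ideal_add:
  assumes "J \<subseteq> carrier A" "K \<subseteq> carrier A"
  shows "loc_ideal (J <+>\<^bsub>A\<^esub> K) \<subseteq> loc_ideal J <+>\<^bsub>localization A S\<^esub> loc_ideal K"
proof
  fix x assume "x \<in> loc_ideal (J <+>\<^bsub>A\<^esub> K)"
  then obtain a b s where x: "x = loc_frac A S (a \<oplus> b) s" "a \<in> J" "b \<in> K" "s \<in> S"
    by (auto simp: loc_ideal_def set_add_def')
  have C: "a \<in> carrier A" "b \<in> carrier A" "s \<in> carrier A"
    using x assms S_carrier by auto
  have "loc_frac A S a s \<oplus>\<^bsub>localization A S\<^esub> loc_frac A S b s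
      = loc_frac A S (s \<otimes> a \<oplus> s \<otimes> b) (s \<otimes> s)"
    using C x(4) by (intro loc_frac_add) auto
  also have "\<dots> = x"
    unfolding x(1) using C by (intro loc_frac_eqI) (simp_all add: r_distr m_ac S_mult x(4))
  finally show "x \<in> loc_ideal J <+>\<^bsub>localization A S\<^esub> loc_ideal K"
    using x(2-4) unfolding set_add_def' loc_ideal_def by blast
qed

text \<open>A fraction \<open>a/1\<close> vanishes exactly when some element of \<open>S\<close>
  kills \<open>a\<close>. Localization can annihilate a nonzero ideal, so a witness that survives is
  carried along.\<close>

lemma loc_ideal_neq_zero:
  assumes "a \<in> J" "a \<in> carrier A" "\<And>s. s \<in> S \<Longrightarrow> s \<otimes> a \<noteq> \<zero>"
  shows "loc_ideal J \<noteq> {\<zero>\<^bsub>localization A S\<^esub>}"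
proof -
  have "loc_frac A S a \<one> \<noteq> loc_frac A S \<zero> \<one>"
    using assms S_one S_carrier by (subst loc_frac_eq_iff) auto
  moreover have "loc_frac A S a \<one> \<in> loc_ideal J" using assms S_one by (auto simp: loc_ideal_def)
  ultimately show ?thesis by (auto simp: zero_localization)
qed

end

text \<open>The maximal ideal of the localization is \<open>loc_ideal p\<close>, since fractions
  with numerator outside \<open>p\<close> are units. Extension respects the zero intersection and
  the covering of \<open>p\<close> by the sum, and \<open>a\<close> and \<open>b\<close> keep both
  extended ideals nonzero.\<close>

lemma depth_localization_at_le_one:
  fixes A (structure)
  assumes p: "primeideal p A"
    and J: "ideal J A" "ideal K A" "J \<inter> K = {\<zero>}" "p \<subseteq> J <+>\<^bsub>A\<^esub> K"
    and a: "a \<in> J" "\<And>s. s \<in> carrier A - p \<Longrightarrow> s \<otimes> a \<noteq> \<zero>"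
    and b: "b \<in> K" "\<And>s. s \<in> carrier A - p \<Longrightarrow> s \<otimes> b \<noteq> \<zero>"
  shows "depth (localization_at A p) \<le> 1"
proof -
  interpret loc_setup A "carrier A - p"
    by (rule loc_setup_compl_prime) fact
  let ?L = "localization_at A p"
  interpret L: cring ?L by (rule cring_localization_at) fact
  interpret J: ideal J A by fact
  interpret K: ideal K A by fact
  note L = localization_at_def[of A p]
  have disj: "p \<inter> (carrier A - p) = {}" by blast
  interpret M: primeideal "loc_ideal p" ?L
    unfolding L by (rule primeideal_loc_ideal[OF p disj])
  show ?thesis
  proof (rule L.depth_le_one_if_ideals_split)
    show "ideal (loc_ideal p) ?L" by (rule M.is_ideal)
    show "loc_ideal p \<noteq> carrier ?L" using M.I_notcarr by simp
    show "carrier ?L - loc_ideal p \<subseteq> Units ?L"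
    proof
      fix x assume x: "x \<in> carrier ?L - loc_ideal p"
      then obtain a s where "x = loc_frac A (carrier A - p) a s" "a \<in> carrier A" "s \<in> carrier A - p"
        unfolding L carrier_localization by blast
      then show "x \<in> Units ?L"
        using x loc_frac_in_Units[of a s] unfolding L loc_ideal_def by blast
    qed
    show "ideal (loc_ideal J) ?L" "ideal (loc_ideal K) ?L"
      unfolding L by (rule ideal_loc_ideal, fact)+
    show "loc_ideal J \<inter> loc_ideal K = {\<zero>\<^bsub>?L\<^esub>}"
      unfolding L by (simp add: loc_ideal_Int J loc_ideal_zero)
    show "loc_ideal J \<noteq> {\<zero>\<^bsub>?L\<^esub>}" "loc_ideal K \<noteq> {\<zero>\<^bsub>?L\<^esub>}"
      unfolding L using a b by (intro loc_ideal_neq_zero[of a] loc_ideal_neq_zero[of b]; auto)+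
    have "loc_ideal p \<subseteq> loc_ideal (J <+>\<^bsub>A\<^esub> K)" using J(4) by (auto simp: loc_ideal_def)
    also have "\<dots> \<subseteq> loc_ideal J <+>\<^bsub>?L\<^esub> loc_ideal K"
      unfolding L by (intro loc_ideal_add J.a_subset K.a_subset)
    finally show "loc_ideal p \<subseteq> loc_ideal J <+>\<^bsub>?L\<^esub> loc_ideal K" .
  qed
qed

text \<open>All members of the chain lie below its top \<open>P n\<close>, hence avoid the
  complement of \<open>P n\<close>; extension keeps such primes prime and their inclusions
  strict.\<close>

lemma krull_dim_localization_at_ge_length:
  fixes n :: nat
  assumes P: "\<And>i. i \<le> n \<Longrightarrow> primeideal (P i) A" "\<And>i. i < n \<Longrightarrow> P i \<subset> P (Suc i)"
  shows "enat n \<le> krull_dim (localization_at A (P n))"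
proof -
  interpret loc_setup A "carrier A - P n"
    by (rule loc_setup_compl_prime) (simp add: P)
  have sub: "P i \<subseteq> P n" if "i \<le> n" for i
    using that
  proof (induction rule: inc_induct)
    case (step k) then show ?case using P(2)[of k] by blast
  qed simp
  have disj: "P i \<inter> (carrier A - P n) = {}" if "i \<le> n" for i
    using sub[OF that] by blast
  have "\<exists>Q. (\<forall>i\<le>n. primeideal (Q i) (localization_at A (P n))) \<and> (\<forall>i<n. Q i \<subset> Q (Suc i))"
    unfolding localization_at_def
    by (intro exI[of _ "\<lambda>i. loc_ideal (P i)"] conjI allI impI primeideal_loc_ideal loc_ideal_mono_strict P disj)
      simp_all
  then show ?thesis
    unfolding krull_dim_def by (intro SUP_upper) simp
qed

subsection \<open>Ideals of a quotient ring\<close>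

context ideal
begin

lemma carrier_quot: "carrier (R Quot I) = (+>) I ` carrier R"
  by (auto simp: FactRing_def A_RCOSETS_def')

lemma rcos_mem_image_iff:
  assumes J: "ideal J R" "I \<subseteq> J" and r: "r \<in> carrier R"
  shows "I +> r \<in> (+>) I ` J \<longleftrightarrow> r \<in> J"
proof -
  have "(+>) I ` J \<subseteq> carrier (R Quot I)"
    using additive_subgroup.a_subset[OF ideal.axioms(1)[OF J(1)]] by (auto simp: carrier_quot)
  moreover have "\<Union> ((+>) I ` J) = J"
    using iffD1[OF ideal_incl_iff[OF is_ideal J(1)] J(2)] by (rule sym)
  ultimately show ?thesis
    using canonical_proj_vimage_mem_iff[OF is_ideal _ r, of "(+>) I ` J"] by simp
qed

lemma rcos_eq_zero_iff:
  assumes "r \<in> carrier R"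
  shows "I +> r = \<zero>\<^bsub>R Quot I\<^esub> \<longleftrightarrow> r \<in> I"
  unfolding FactRing_def using rcos_const_imp_mem[OF assms] a_rcos_zero[OF is_ideal, of r] by auto

lemma primeideal_rcos_image:
  assumes "cring R" and P: "primeideal P R" "I \<subseteq> P"
  shows "primeideal ((+>) I ` P) (R Quot I)"
proof (rule primeidealI)
  interpret P: primeideal P R by fact
  show "ideal ((+>) I ` P) (R Quot I)"
    by (rule ring_ideal_imp_quot_ideal[OF is_ideal P.is_ideal])
  show "cring (R Quot I)" by (rule quotient_is_cring) fact
  note mem = rcos_mem_image_iff[OF P.is_ideal P(2)]
  have "\<one> \<notin> P" using P.one_imp_carrier P.I_notcarr by auto
  then have "I +> \<one> \<notin> (+>) I ` P" using mem by simp
  then show "carrier (R Quot I) \<noteq> (+>) I ` P" by (auto simp: carrier_quot)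
  fix x y assume "x \<in> carrier (R Quot I)" "y \<in> carrier (R Quot I)"
    and xy: "x \<otimes>\<^bsub>R Quot I\<^esub> y \<in> (+>) I ` P"
  then obtain r s where rs: "x = I +> r" "y = I +> s" "r \<in> carrier R" "s \<in> carrier R"
    by (auto simp: carrier_quot)
  then have "I +> (r \<otimes> s) \<in> (+>) I ` P"
    using xy ring_hom_mult[OF rcos_ring_hom, of r s] by simp
  then have "r \<in> P \<or> s \<in> P"
    using rs mem P.I_prime by simp
  then show "x \<in> (+>) I ` P \<or> y \<in> (+>) I ` P" using rs by blast
qed

lemma maximalideal_rcos_image:
  assumes P: "maximalideal P R" "I \<subseteq> P"
  shows "maximalideal ((+>) I ` P) (R Quot I)"
proof (rule maximalidealI)
  interpret P: maximalideal P R by fact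
  show "ideal ((+>) I ` P) (R Quot I)"
    by (rule ring_ideal_imp_quot_ideal[OF is_ideal P.is_ideal])
  note mem = rcos_mem_image_iff[OF P.is_ideal P(2)]
  have "\<one> \<notin> P" using P.one_imp_carrier P.I_notcarr by auto
  then have "I +> \<one> \<notin> (+>) I ` P" using mem by simp
  then show "carrier (R Quot I) \<noteq> (+>) I ` P" by (auto simp: carrier_quot)
  fix J assume J: "ideal J (R Quot I)" "(+>) I ` P \<subseteq> J" "J \<subseteq> carrier (R Quot I)"
  have id: "ideal {r \<in> carrier R. I +> r \<in> J} R"
    by (rule ring_hom_ring.ideal_vimage[OF rcos_ring_hom_ring J(1)])
  have J_eq: "J = (+>) I ` {r \<in> carrier R. I +> r \<in> J}"
    using J(3) by (auto simp: carrier_quot)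
  have "{r \<in> carrier R. I +> r \<in> J} = P \<or> {r \<in> carrier R. I +> r \<in> J} = carrier R"
    using J(2) P.Icarr by (intro P.I_maximal id) blast+
  then show "J = (+>) I ` P \<or> J = carrier (R Quot I)"
    unfolding carrier_quot by (subst (1 2) J_eq) auto
qed

lemma rcos_image_add:
  assumes "J \<subseteq> carrier R" "K \<subseteq> carrier R"
  shows "(+>) I ` (J <+>\<^bsub>R\<^esub> K) \<subseteq> (+>) I ` J <+>\<^bsub>R Quot I\<^esub> (+>) I ` K"
proof
  fix x assume "x \<in> (+>) I ` (J <+>\<^bsub>R\<^esub> K)"
  then obtain a b where x: "x = I +> (a \<oplus> b)" "a \<in> J" "b \<in> K" by (auto simp: set_add_def')
  then have "x = (I +> a) \<oplus>\<^bsub>R Quot I\<^esub> (I +> b)"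
    using assms ring_hom_add[OF rcos_ring_hom, of a b] by blast
  then show "x \<in> (+>) I ` J <+>\<^bsub>R Quot I\<^esub> (+>) I ` K"
    using x unfolding set_add_def' by blast
qed

text \<open>Two strict steps up to \<open>M\<close> make the dimension at the image of
  \<open>M\<close> at least 2, while the split makes the depth there at most 1. All hypotheses are
  stated in \<open>R\<close>, where polynomials can be inspected term by term.\<close>

lemma not_cohen_macaulay_quot_if_ideals_split:
  assumes "cring R"
    and P: "primeideal P0 R" "primeideal P1 R" "maximalideal M R" "P0 \<subset> P1" "P1 \<subset> M" "I \<subseteq> P0"
    and J: "ideal J R" "ideal K R" "J \<inter> K = I" "M \<subseteq> J <+>\<^bsub>R\<^esub> K"
    and a: "a \<in> J" "\<And>s. s \<in> carrier R - M \<Longrightarrow> s \<otimes> a \<notin> I"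
    and b: "b \<in> K" "\<And>s. s \<in> carrier R - M \<Longrightarrow> s \<otimes> b \<notin> I"
  shows "\<not> cohen_macaulay_ring (R Quot I)"
proof
  assume CM: "cohen_macaulay_ring (R Quot I)"
  interpret J: ideal J R by fact
  interpret K: ideal K R by fact
  interpret M: maximalideal M R by fact
  let ?Q = "R Quot I" and ?h = "(+>) I"
  have primeM: "primeideal M R"
    using cring.maximalideal_prime assms(1) P(3) by blast
  have sub: "I \<subseteq> P1" "I \<subseteq> M" "I \<subseteq> J" "I \<subseteq> K" using P J(3) by auto
  note mem = rcos_mem_image_iff
  have strict: "?h ` A \<subset> ?h ` B" if AB: "ideal A R" "ideal B R" "I \<subseteq> A" "A \<subset> B" for A B
  proof -
    obtain x where x: "x \<in> B" "x \<notin> A" using AB by blast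
    then have "?h x \<in> ?h ` B - ?h ` A"
      using mem[OF AB(1,3)] ideal.Icarr[OF AB(2)] by blast
    then show ?thesis using AB(4) by blast
  qed
  define Ps where "Ps i = ?h ` (if i = 0 then P0 else if i = 1 then P1 else M)" for i :: nat
  have "enat 2 \<le> krull_dim (localization_at ?Q (Ps 2))"
  proof (rule krull_dim_localization_at_ge_length)
    show "primeideal (Ps i) ?Q" if "i \<le> 2" for i
      using P primeM sub by (auto simp: Ps_def intro!: primeideal_rcos_image assms(1))
    show "Ps i \<subset> Ps (Suc i)" if "i < 2" for i
    proof -
      have "i = 0 \<or> i = 1" using that by auto
      moreover have "?h ` P0 \<subset> ?h ` P1" "?h ` P1 \<subset> ?h ` M"
        using P sub M.is_ideal by (intro strict; simp add: primeideal.axioms(1))+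
      ultimately show ?thesis by (auto simp: Ps_def)
    qed
  qed
  moreover have "depth (localization_at ?Q (?h ` M)) \<le> 1"
  proof (rule depth_localization_at_le_one)
    show "primeideal (?h ` M) ?Q" using assms(1) primeM sub(2) by (rule primeideal_rcos_image)
    show "ideal (?h ` J) ?Q" "ideal (?h ` K) ?Q"
      by (rule ring_ideal_imp_quot_ideal[OF is_ideal], fact)+
    show "?h ` J \<inter> ?h ` K = {\<zero>\<^bsub>?Q\<^esub>}"
    proof (intro equalityI subsetI)
      fix x assume x: "x \<in> ?h ` J \<inter> ?h ` K"
      then obtain r where r: "r \<in> J" "x = ?h r" by blast
      then have "r \<in> K" using x mem[OF J(2) sub(4)] J.Icarr by auto
      then have "r \<in> I" using r J(3) by blast
      then show "x \<in> {\<zero>\<^bsub>?Q\<^esub>}" using r rcos_eq_zero_iff J.Icarr by simp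
    next
      fix x assume "x \<in> {\<zero>\<^bsub>?Q\<^esub>}"
      then have "x = ?h \<zero>" using rcos_eq_zero_iff[of \<zero>] zero_closed by simp
      then show "x \<in> ?h ` J \<inter> ?h ` K" using J.zero_closed K.zero_closed by blast
    qed
    show "?h ` M \<subseteq> ?h ` J <+>\<^bsub>?Q\<^esub> ?h ` K"
      using J(4) rcos_image_add[OF J.a_subset K.a_subset] by blast
    have ne: "s \<otimes>\<^bsub>?Q\<^esub> ?h c \<noteq> \<zero>\<^bsub>?Q\<^esub>"
      if s: "s \<in> carrier ?Q - ?h ` M" and c: "c \<in> carrier R" "\<And>s. s \<in> carrier R - M \<Longrightarrow> s \<otimes> c \<notin> I"
      for s c
    proof -
      obtain r where r: "r \<in> carrier R" "s = ?h r" "r \<notin> M" using s by (auto simp: carrier_quot)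
      then have "r \<otimes> c \<notin> I" using c by blast
      then show ?thesis
        using r c(1) ring_hom_mult[OF rcos_ring_hom r(1) c(1)] rcos_eq_zero_iff[of "r \<otimes> c"] by simp
    qed
    show "?h a \<in> ?h ` J" "?h b \<in> ?h ` K" using a b by auto
    show "s \<otimes>\<^bsub>?Q\<^esub> ?h a \<noteq> \<zero>\<^bsub>?Q\<^esub>" if "s \<in> carrier ?Q - ?h ` M" for s
      using ne[OF that J.Icarr[OF a(1)] a(2)] .
    show "s \<otimes>\<^bsub>?Q\<^esub> ?h b \<noteq> \<zero>\<^bsub>?Q\<^esub>" if "s \<in> carrier ?Q - ?h ` M" for s
      using ne[OF that K.Icarr[OF b(1)] b(2)] .
  qed
  moreover have "maximalideal (?h ` M) ?Q" by (rule maximalideal_rcos_image[OF P(3) sub(2)])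
  ultimately have "enat 2 \<le> 1"
    using CM unfolding cohen_macaulay_ring_def by (simp add: Ps_def)
  then show False by (simp add: one_enat_def)
qed

end


subsection \<open>Monomial ideals\<close>

lemma mpoly_ring_simps:
  "carrier (mpoly_ring K V) = {p. \<forall>m \<in> Poly_Mapping.keys p. Poly_Mapping.keys m \<subseteq> V}"
  "p \<otimes>\<^bsub>mpoly_ring K V\<^esub> q = p * q" "p \<oplus>\<^bsub>mpoly_ring K V\<^esub> q = p + q"
  "\<zero>\<^bsub>mpoly_ring K V\<^esub> = 0" "\<one>\<^bsub>mpoly_ring K V\<^esub> = 1"
  by (simp_all add: mpoly_ring_def ring_of_type_algebra_def)

section \<open>Exponent vectors and coefficients of products\<close>

lemma keys_add_nat: "Poly_Mapping.keys (m + k :: 'v \<Rightarrow>\<^sub>0 nat) = Poly_Mapping.keys m \<union> Poly_Mapping.keys k"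
  by (auto simp: in_keys_iff lookup_add)

lemma lookup_sum_single:
  assumes "finite A"
  shows "Poly_Mapping.lookup (\<Sum>m\<in>A. Poly_Mapping.single m (c m)) k = (if k \<in> A then c k else 0)"
proof -
  have "Poly_Mapping.lookup (\<Sum>m\<in>A. Poly_Mapping.single m (c m)) k = (\<Sum>m\<in>A. if m = k then c m else 0)"
    by (simp add: lookup_sum lookup_single when_def)
  then show ?thesis using assms by simp
qed

lemma poly_mapping_eq_sum_single:
  "p = (\<Sum>m\<in>Poly_Mapping.keys p. Poly_Mapping.single m (Poly_Mapping.lookup p m))"
  by (rule poly_mapping_eqI) (simp add: lookup_sum_single in_keys_iff)

text \<open>The variables carry no order, so leading terms for a monomial order are not at hand.
  Instead the coordinates in \<open>U\<close> are treated one at a time, keeping in each set only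
  the elements with the largest exponent of \<open>u\<close>; this imitates a lexicographic order on
  finitely many variables.\<close>

lemma unique_product_of_finite_agreeing:
  fixes A B :: "('v \<Rightarrow>\<^sub>0 nat) set"
  assumes "finite U" "finite A" "finite B" "A \<noteq> {}" "B \<noteq> {}"
    and "\<And>k k' v. k \<in> A \<Longrightarrow> k' \<in> A \<Longrightarrow> v \<notin> U \<Longrightarrow> Poly_Mapping.lookup k v = Poly_Mapping.lookup k' v"
    and "\<And>k k' v. k \<in> B \<Longrightarrow> k' \<in> B \<Longrightarrow> v \<notin> U \<Longrightarrow> Poly_Mapping.lookup k v = Poly_Mapping.lookup k' v"
  shows "\<exists>m\<in>A. \<exists>n\<in>B. \<forall>k\<in>A. \<forall>l\<in>B. m + n = k + l \<longrightarrow> k = m \<and> l = n"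
  using assms
proof (induction U arbitrary: A B rule: finite_induct)
  case empty
  then obtain m n where "m \<in> A" "n \<in> B" by blast
  moreover have "k = m" if "k \<in> A" for k
    using empty(5)[OF that \<open>m \<in> A\<close>] by (intro poly_mapping_eqI) simp
  moreover have "k = n" if "k \<in> B" for k
    using empty(6)[OF that \<open>n \<in> B\<close>] by (intro poly_mapping_eqI) simp
  ultimately show ?case by blast
next
  case (insert u U)
  define top where "top Z = {k \<in> Z. Poly_Mapping.lookup k u = Max ((\<lambda>k. Poly_Mapping.lookup k u) ` Z)}"
    for Z :: "('v \<Rightarrow>\<^sub>0 nat) set"
  have top: "finite (top Z)" "top Z \<noteq> {}" if "finite Z" "Z \<noteq> {}" for Z
  proof -
    have "Max ((\<lambda>k. Poly_Mapping.lookup k u) ` Z) \<in> (\<lambda>k. Poly_Mapping.lookup k u) ` Z"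
      using that by (intro Max_in) auto
    then show "top Z \<noteq> {}" by (auto simp: top_def)
  qed (use that in \<open>simp add: top_def\<close>)
  have le: "Poly_Mapping.lookup k u \<le> Poly_Mapping.lookup m u" if "finite Z" "k \<in> Z" "m \<in> top Z" for Z k m
    using that by (simp add: top_def)
  have topI: "k \<in> top Z" if "finite Z" "k \<in> Z" "m \<in> top Z" "Poly_Mapping.lookup k u = Poly_Mapping.lookup m u"
    for Z k m
    using that by (simp add: top_def)
  have agree: "Poly_Mapping.lookup k v = Poly_Mapping.lookup k' v"
    if "k \<in> top Z" "k' \<in> top Z" "v \<notin> U"
      "\<And>k k' v. k \<in> Z \<Longrightarrow> k' \<in> Z \<Longrightarrow> v \<notin> insert u U \<Longrightarrow> Poly_Mapping.lookup k v = Poly_Mapping.lookup k' v"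
    for Z k k' v
    using that(1-3) that(4)[of k k' v] by (cases "v = u") (auto simp: top_def)
  \<comment> \<open>Within \<open>top A\<close>, and likewise within \<open>top B\<close>, all
    elements agree at \<open>u\<close>, so only coordinates in \<open>U\<close> can still tell them
    apart.\<close>
  have "\<exists>m\<in>top A. \<exists>n\<in>top B. \<forall>k\<in>top A. \<forall>l\<in>top B. m + n = k + l \<longrightarrow> k = m \<and> l = n"
    using insert.prems
    by (intro insert.IH top) (blast intro: agree[of _ A] agree[of _ B])+
  then obtain m n where mn: "m \<in> top A" "n \<in> top B"
      "\<And>k l. k \<in> top A \<Longrightarrow> l \<in> top B \<Longrightarrow> m + n = k + l \<Longrightarrow> k = m \<and> l = n"
    by blast
  have "k = m \<and> l = n" if kl: "k \<in> A" "l \<in> B" "m + n = k + l" for k l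
  proof -
    \<comment> \<open>The exponents of \<open>u\<close> in \<open>m\<close> and \<open>n\<close> are
      maximal in \<open>A\<close> and \<open>B\<close>, so an equal sum forces \<open>k\<close> and
      \<open>l\<close> to attain them too and to lie in the top parts.\<close>
    have "Poly_Mapping.lookup m u + Poly_Mapping.lookup n u = Poly_Mapping.lookup k u + Poly_Mapping.lookup l u"
      using kl(3) by (metis lookup_add)
    then have "Poly_Mapping.lookup k u = Poly_Mapping.lookup m u" "Poly_Mapping.lookup l u = Poly_Mapping.lookup n u"
      using le[OF insert.prems(1) kl(1) mn(1)] le[OF insert.prems(2) kl(2) mn(2)] by linarith+
    then show ?thesis
      using mn kl topI insert.prems(1,2) by blast
  qed
  moreover have "m \<in> A" "n \<in> B" using mn by (simp_all add: top_def)
  ultimately show ?case by blast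
qed

lemma unique_product:
  fixes A B :: "('v \<Rightarrow>\<^sub>0 nat) set"
  assumes "finite A" "finite B" "A \<noteq> {}" "B \<noteq> {}"
  obtains m n where "m \<in> A" "n \<in> B" "\<And>k l. k \<in> A \<Longrightarrow> l \<in> B \<Longrightarrow> m + n = k + l \<Longrightarrow> k = m \<and> l = n"
proof -
  \<comment> \<open>Take for \<open>U\<close> the finitely many variables that occur; elsewhere all
    exponents are zero and hence agree.\<close>
  have "\<exists>m\<in>A. \<exists>n\<in>B. \<forall>k\<in>A. \<forall>l\<in>B. m + n = k + l \<longrightarrow> k = m \<and> l = n"
    using assms
    by (intro unique_product_of_finite_agreeing[of "\<Union> (Poly_Mapping.keys ` (A \<union> B))"])
      (auto simp: in_keys_iff)
  then show thesis using that by blast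
qed

lemma lookup_times_unique:
  fixes p q :: "('v \<Rightarrow>\<^sub>0 nat) \<Rightarrow>\<^sub>0 'k::field"
  assumes "\<And>k l. k \<in> Poly_Mapping.keys p \<Longrightarrow> l \<in> Poly_Mapping.keys q \<Longrightarrow> m + n = k + l \<Longrightarrow> k = m \<and> l = n"
  shows "Poly_Mapping.lookup (p * q) (m + n) = Poly_Mapping.lookup p m * Poly_Mapping.lookup q n"
proof -
  have "Poly_Mapping.lookup (p * q) (m + n)
      = (\<Sum>(k, l). Poly_Mapping.lookup p k * Poly_Mapping.lookup q l when m + n = k + l)"
    by (simp add: times_poly_mapping.rep_eq prod_fun_unfold_prod)
  also have "\<dots> = (\<Sum>kl. Poly_Mapping.lookup p m * Poly_Mapping.lookup q n when kl = (m, n))"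
  proof (rule Sum_any.cong)
    fix kl :: "('v \<Rightarrow>\<^sub>0 nat) \<times> ('v \<Rightarrow>\<^sub>0 nat)"
    obtain k l where kl: "kl = (k, l)" by (cases kl)
    have "Poly_Mapping.lookup p k * Poly_Mapping.lookup q l = 0" if "m + n = k + l" "(k, l) \<noteq> (m, n)"
      using assms[of k l] that by (auto simp: in_keys_iff)
    then show "(case kl of (k, l) \<Rightarrow> Poly_Mapping.lookup p k * Poly_Mapping.lookup q l when m + n = k + l)
        = (Poly_Mapping.lookup p m * Poly_Mapping.lookup q n when kl = (m, n))"
      unfolding kl by (auto simp: when_def)
  qed
  finally show ?thesis by simp
qed

section \<open>Ideals given by a set of admissible exponent vectors\<close>

definition monomial_ideal where
  "monomial_ideal K V T = {p \<in> carrier (mpoly_ring K V). Poly_Mapping.keys p \<subseteq> T}"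

text \<open>For \<open>W\<close> inside \<open>V\<close>, the ideal generated by the variables in
  \<open>W\<close>. When \<open>W\<close> is a vertex cover it is the prime attached to the
  independent set \<open>V - W\<close>; for \<open>W = V\<close> it is the irrelevant maximal
  ideal.\<close>

abbreviation face_ideal where
  "face_ideal K V W \<equiv> monomial_ideal K V {m. Poly_Mapping.keys m \<inter> W \<noteq> {}}"

lemma monomial_ideal_mono: "T \<subseteq> T' \<Longrightarrow> monomial_ideal K V T \<subseteq> monomial_ideal K V T'"
  by (auto simp: monomial_ideal_def)

lemma monomial_ideal_Int: "monomial_ideal K V T \<inter> monomial_ideal K V T' = monomial_ideal K V (T \<inter> T')"
  by (auto simp: monomial_ideal_def)

lemma ideal_monomial_ideal:
  fixes K :: "'k::field itself"
  assumes "\<And>m k. m \<in> T \<Longrightarrow> m + k \<in> T"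
  shows "ideal (monomial_ideal K V T) (mpoly_ring K V)"
proof -
  interpret R: cring "mpoly_ring K V" by (rule cring_mpoly_ring)
  have minus: "\<ominus>\<^bsub>mpoly_ring K V\<^esub> p = - p" if "p \<in> carrier (mpoly_ring K V)" for p
    using that by (intro R.minus_equality) (auto simp: mpoly_ring_simps)
  have mult: "x * a \<in> monomial_ideal K V T"
    if "a \<in> monomial_ideal K V T" "x \<in> carrier (mpoly_ring K V)" for a x
  proof -
    have "x * a \<in> carrier (mpoly_ring K V)"
      using R.m_closed[of x a] that by (simp add: monomial_ideal_def mpoly_ring_simps(2))
    moreover have "Poly_Mapping.keys (x * a) \<subseteq> T"
    proof
      fix m assume "m \<in> Poly_Mapping.keys (x * a)"
      then obtain u v where "m = u + v" "v \<in> Poly_Mapping.keys a"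
        using keys_mult[of x a] by blast
      then show "m \<in> T" using that(1) assms[of v u] by (auto simp: monomial_ideal_def add.commute)
    qed
    ultimately show ?thesis by (simp add: monomial_ideal_def)
  qed
  show ?thesis
  proof (rule idealI)
    show "subgroup (monomial_ideal K V T) (add_monoid (mpoly_ring K V))"
    proof (rule R.add.subgroupI)
      show "monomial_ideal K V T \<subseteq> carrier (mpoly_ring K V)" by (auto simp: monomial_ideal_def)
      have "0 \<in> monomial_ideal K V T" by (simp add: monomial_ideal_def mpoly_ring_simps)
      then show "monomial_ideal K V T \<noteq> {}" by blast
    next
      fix p assume "p \<in> monomial_ideal K V T"
      then show "\<ominus>\<^bsub>mpoly_ring K V\<^esub> p \<in> monomial_ideal K V T"
        by (simp add: monomial_ideal_def minus) (simp add: mpoly_ring_simps)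
    next
      fix p q assume "p \<in> monomial_ideal K V T" "q \<in> monomial_ideal K V T"
      then show "p \<oplus>\<^bsub>mpoly_ring K V\<^esub> q \<in> monomial_ideal K V T"
        using Poly_Mapping.keys_add[of p q] unfolding monomial_ideal_def mpoly_ring_simps by blast
    qed
  qed (use mult in \<open>auto simp: mpoly_ring_simps(2) mult.commute intro: R.ring_axioms\<close>)
qed

lemma ideal_face_ideal: "ideal (face_ideal K V W) (mpoly_ring (K :: 'k::field itself) V)"
  by (rule ideal_monomial_ideal) (auto simp: keys_add_nat)

text \<open>Two monomials avoiding \<open>W\<close>, one in each factor, whose product arises in only one way
  witness that the product of two polynomials outside the ideal stays outside.\<close>

lemma primeideal_face_ideal: "primeideal (face_ideal K V W) (mpoly_ring (K :: 'k::field itself) V)"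
proof (rule primeidealI)
  show "ideal (face_ideal K V W) (mpoly_ring K V)" by (rule ideal_face_ideal)
  show "cring (mpoly_ring K V)" by (rule cring_mpoly_ring)
  have "1 \<in> carrier (mpoly_ring K V)" "1 \<notin> face_ideal K V W"
    by (auto simp: mpoly_ring_simps monomial_ideal_def)
  then show "carrier (mpoly_ring K V) \<noteq> face_ideal K V W" by blast
  fix p q assume pq: "p \<in> carrier (mpoly_ring K V)" "q \<in> carrier (mpoly_ring K V)"
    "p \<otimes>\<^bsub>mpoly_ring K V\<^esub> q \<in> face_ideal K V W"
  show "p \<in> face_ideal K V W \<or> q \<in> face_ideal K V W"
  proof (rule ccontr)
    assume neg: "\<not> ?thesis"
    \<comment> \<open>The terms that survive when the variables in \<open>W\<close> are set to zero;
      for \<open>r\<close> in the ring there are some exactly when \<open>r\<close> is outside the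
      ideal.\<close>
    define low where "low r = {m \<in> Poly_Mapping.keys r. Poly_Mapping.keys m \<inter> W = {}}"
      for r :: "('a \<Rightarrow>\<^sub>0 nat) \<Rightarrow>\<^sub>0 'k"
    have "low p \<noteq> {}" "low q \<noteq> {}" using neg pq by (auto simp: low_def monomial_ideal_def)
    moreover have "finite (low r)" for r by (simp add: low_def)
    ultimately obtain m n where mn: "m \<in> low p" "n \<in> low q"
        "\<And>k l. k \<in> low p \<Longrightarrow> l \<in> low q \<Longrightarrow> m + n = k + l \<Longrightarrow> k = m \<and> l = n"
      by (metis unique_product)
    have low_mn: "Poly_Mapping.keys (m + n) \<inter> W = {}"
      using mn by (auto simp: low_def keys_add_nat)
    have "Poly_Mapping.lookup (p * q) (m + n) = Poly_Mapping.lookup p m * Poly_Mapping.lookup q n"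
    proof (rule lookup_times_unique)
      fix k l assume kl: "k \<in> Poly_Mapping.keys p" "l \<in> Poly_Mapping.keys q" "m + n = k + l"
      \<comment> \<open>Exponents are natural numbers and cannot cancel: if \<open>m + n\<close>
        avoids \<open>W\<close>, so do both summands of any decomposition.\<close>
      then have "k \<in> low p" "l \<in> low q" using low_mn by (auto simp: low_def keys_add_nat)
      then show "k = m \<and> l = n" using mn(3) kl(3) by blast
    qed
    then have "m + n \<in> Poly_Mapping.keys (p * q)"
      using mn by (auto simp: low_def in_keys_iff)
    then show False using pq(3) low_mn by (auto simp: mpoly_ring_simps monomial_ideal_def)
  qed
qed

text \<open>Split the polynomial term by term. Terms with exponent in both sets go to the first
  summand, and what remains has its exponents in \<open>T'\<close>.\<close>

lemma monomial_ideal_Un_subset_add: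
  "monomial_ideal K V (T \<union> T') \<subseteq> monomial_ideal K V T <+>\<^bsub>mpoly_ring K V\<^esub> monomial_ideal K V T'"
proof
  fix p assume p: "p \<in> monomial_ideal K V (T \<union> T')"
  define f where "f A = (\<Sum>m\<in>A. Poly_Mapping.single m (Poly_Mapping.lookup p m))" for A
  have keys_f: "Poly_Mapping.keys (f A) \<subseteq> Poly_Mapping.keys p \<inter> A" if "finite A" for A
    using that by (auto simp: f_def lookup_sum_single in_keys_iff split: if_splits)
  have "f (Poly_Mapping.keys p \<inter> T) \<in> monomial_ideal K V T"
       "f (Poly_Mapping.keys p - T) \<in> monomial_ideal K V T'"
    using p keys_f[of "Poly_Mapping.keys p \<inter> T"] keys_f[of "Poly_Mapping.keys p - T"]
    by (auto simp: monomial_ideal_def mpoly_ring_simps)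
  moreover have "p = f (Poly_Mapping.keys p \<inter> T) + f (Poly_Mapping.keys p - T)"
    by (rule poly_mapping_eqI) (simp add: f_def lookup_add lookup_sum_single in_keys_iff)
  ultimately show "p \<in> monomial_ideal K V T <+>\<^bsub>mpoly_ring K V\<^esub> monomial_ideal K V T'"
    unfolding set_add_def' mpoly_ring_simps by blast
qed

text \<open>A polynomial outside the ideal has a nonzero constant term, and the rest of it lies in
  the ideal. A larger ideal therefore contains a nonzero constant, which is invertible over a
  field.\<close>

lemma maximalideal_face_ideal: "maximalideal (face_ideal K V V) (mpoly_ring (K :: 'k::field itself) V)"
proof (rule maximalidealI)
  let ?R = "mpoly_ring K V" and ?M = "face_ideal K V V"
  interpret R: cring ?R by (rule cring_mpoly_ring)
  show "ideal ?M ?R" by (rule ideal_face_ideal)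
  show "carrier ?R \<noteq> ?M" using primeideal.I_notcarr[OF primeideal_face_ideal] .
  fix J assume J: "ideal J ?R" "?M \<subseteq> J" "J \<subseteq> carrier ?R"
  interpret J: ideal J ?R by fact
  show "J = ?M \<or> J = carrier ?R"
  proof (rule disjCI)
    assume "J \<noteq> carrier ?R"
    have "q \<in> ?M" if q: "q \<in> J" for q
    proof (rule ccontr)
      assume nq: "q \<notin> ?M"
      define c where "c = Poly_Mapping.lookup q 0"
      have qc: "q \<in> carrier ?R" using q J(3) by blast
      obtain m where "m \<in> Poly_Mapping.keys q" "Poly_Mapping.keys m \<inter> V = {}"
        using nq qc by (auto simp: monomial_ideal_def)
      moreover from this have "Poly_Mapping.keys m = {}" using qc unfolding mpoly_ring_simps by blast
      ultimately have c: "c \<noteq> 0" by (simp add: c_def in_keys_iff)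
      have "Poly_Mapping.single 0 c - q \<in> ?M"
      proof -
        have "m \<in> Poly_Mapping.keys q \<and> m \<noteq> 0" if "m \<in> Poly_Mapping.keys (Poly_Mapping.single 0 c - q)" for m
          using that by (auto simp: in_keys_iff lookup_minus lookup_single c_def when_def split: if_splits)
        moreover have "Poly_Mapping.keys m \<subseteq> V" if "m \<in> Poly_Mapping.keys q" for m
          using qc that by (simp add: mpoly_ring_simps)
        ultimately have "Poly_Mapping.keys m \<subseteq> V \<and> Poly_Mapping.keys m \<inter> V \<noteq> {}"
          if "m \<in> Poly_Mapping.keys (Poly_Mapping.single 0 c - q)" for m
          using that keys_eq_empty[of m] by blast
        then show ?thesis
          unfolding monomial_ideal_def mpoly_ring_simps by blast
      qed
      then have "q \<oplus>\<^bsub>?R\<^esub> (Poly_Mapping.single 0 c - q) \<in> J"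
        using q J(2) by (intro J.a_closed) auto
      then have "Poly_Mapping.single 0 (inverse c) \<otimes>\<^bsub>?R\<^esub> Poly_Mapping.single 0 c \<in> J"
        using c by (intro J.I_l_closed) (auto simp: mpoly_ring_simps)
      then have "\<one>\<^bsub>?R\<^esub> \<in> J" using c by (simp add: mpoly_ring_simps mult_single)
      then show False using J.one_imp_carrier \<open>J \<noteq> carrier ?R\<close> by blast
    qed
    then show "J = ?M" using J(2) by blast
  qed
qed

section \<open>Variables and the edge ideal\<close>

lemma poly_var_in_face_ideal_iff:
  "(poly_var v :: _ \<Rightarrow>\<^sub>0 'k) \<in> face_ideal (K :: 'k::field itself) V W \<longleftrightarrow> v \<in> V \<and> v \<in> W"
  by (auto simp: monomial_ideal_def mpoly_ring_simps poly_var_def)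

text \<open>The endpoints of an edge are distinct, so a term is divisible by their product as soon
  as both occur in its support. Membership in the edge ideal thus becomes a condition on the
  supports of single terms.\<close>

lemma edge_ideal_eq_monomial_ideal:
  fixes K :: "'k::field itself"
  assumes "simple_graph G"
  shows "edge_ideal K G = monomial_ideal K (verts G) {m. \<exists>e\<in>edges G. e \<subseteq> Poly_Mapping.keys m}"
    (is "_ = ?M")
proof
  let ?R = "mpoly_ring K (verts G)"
  interpret R: cring ?R by (rule cring_mpoly_ring)
  interpret E: ideal "edge_ideal K G" ?R by (rule ideal_edge_ideal) fact
  have edge: "x \<in> verts G \<and> y \<in> verts G \<and> x \<noteq> y" if "{x, y} \<in> edges G" for x y
    using assms that unfolding simple_graph_def by fastforce
  have "poly_var x \<otimes>\<^bsub>?R\<^esub> poly_var y \<in> ?M" if "{x, y} \<in> edges G" for x y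
    using edge[OF that] that
    by (auto simp: monomial_ideal_def mpoly_ring_simps poly_var_def mult_single keys_add_nat intro!: bexI[of _ "{x, y}"])
  then have gen: "{poly_var x \<otimes>\<^bsub>?R\<^esub> poly_var y | x y. {x, y} \<in> edges G} \<subseteq> ?M"
    by blast
  have "ideal ?M ?R" by (rule ideal_monomial_ideal) (auto simp: keys_add_nat)
  then show "edge_ideal K G \<subseteq> ?M"
    unfolding edge_ideal_def using gen by (rule R.genideal_minimal)
  have gen_sub: "{poly_var x \<otimes>\<^bsub>?R\<^esub> poly_var y | x y. {x, y} \<in> edges G} \<subseteq> edge_ideal K G"
    unfolding edge_ideal_def using gen by (intro R.genideal_self) (auto simp: monomial_ideal_def)
  have term_mem: "Poly_Mapping.single m c \<in> edge_ideal K G"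
    if m: "Poly_Mapping.keys m \<subseteq> verts G" "e \<in> edges G" "e \<subseteq> Poly_Mapping.keys m" for m c e
  proof -
    obtain x y where e: "e = {x, y}" "x \<noteq> y"
      using assms m(2) unfolding simple_graph_def by (metis card_2_iff)
    \<comment> \<open>Subtraction of exponents is truncated; it is exact here because both endpoints
      occur in \<open>m\<close> and are distinct.\<close>
    define m' where "m' = m - (Poly_Mapping.single x 1 + Poly_Mapping.single y 1)"
    have m_eq: "m = m' + (Poly_Mapping.single x 1 + Poly_Mapping.single y 1)"
      using m(3) e by (intro poly_mapping_eqI)
        (auto simp: m'_def lookup_add lookup_minus lookup_single when_def in_keys_iff)
    have "Poly_Mapping.keys m' \<subseteq> verts G"
      using m(1) by (subst (asm) m_eq) (simp add: keys_add_nat)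
    then have "Poly_Mapping.single m' c \<in> carrier ?R"
      by (simp add: mpoly_ring_simps)
    moreover have "poly_var x \<otimes>\<^bsub>?R\<^esub> poly_var y \<in> edge_ideal K G"
      using gen_sub m(2) e by blast
    ultimately have "Poly_Mapping.single m' c \<otimes>\<^bsub>?R\<^esub> (poly_var x \<otimes>\<^bsub>?R\<^esub> poly_var y) \<in> edge_ideal K G"
      by (rule E.I_l_closed[rotated])
    moreover have "Poly_Mapping.single m' c \<otimes>\<^bsub>?R\<^esub> (poly_var x \<otimes>\<^bsub>?R\<^esub> poly_var y) = Poly_Mapping.single m c"
      by (subst m_eq) (simp add: mpoly_ring_simps poly_var_def mult_single)
    ultimately show ?thesis by simp
  qed
  show "?M \<subseteq> edge_ideal K G"
  proof
    fix p assume p: "p \<in> ?M"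
    have "(\<Sum>m\<in>A. Poly_Mapping.single m (Poly_Mapping.lookup p m)) \<in> edge_ideal K G"
      if "finite A" "A \<subseteq> Poly_Mapping.keys p" for A
      using that
    proof (induction A rule: finite_induct)
      case empty
      then show ?case using E.zero_closed by (simp add: mpoly_ring_simps)
    next
      case (insert m A)
      have "Poly_Mapping.single m (Poly_Mapping.lookup p m) \<in> edge_ideal K G"
        using p insert.prems term_mem[of m] by (auto simp: monomial_ideal_def mpoly_ring_simps)
      then show ?case
        using insert E.a_closed by (simp add: mpoly_ring_simps)
    qed
    then show "p \<in> edge_ideal K G"
      using poly_mapping_eq_sum_single[of p] by (metis finite_keys order_refl)
  qed
qed

lemma edge_ideal_subset_face_ideal:
  assumes "simple_graph G" "\<And>e. e \<in> edges G \<Longrightarrow> e \<inter> W \<noteq> {}"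
  shows "edge_ideal K G \<subseteq> face_ideal K (verts G) W"
  unfolding edge_ideal_eq_monomial_ideal[OF assms(1)]
  using assms(2) by (intro monomial_ideal_mono) blast

text \<open>An edge has two endpoints, so removing \<open>v\<close> from the vertex set leaves a
  vertex cover. Its prime contains the edge ideal but not the variable of \<open>v\<close>, so it
  would have to contain \<open>s\<close>, although it lies in the maximal ideal.\<close>

lemma times_poly_var_notin_edge_ideal:
  fixes K :: "'k::field itself"
  assumes "simple_graph G" "v \<in> verts G"
    and s: "s \<in> carrier (mpoly_ring K (verts G)) - face_ideal K (verts G) (verts G)"
  shows "s \<otimes>\<^bsub>mpoly_ring K (verts G)\<^esub> poly_var v \<notin> edge_ideal K G"
proof
  let ?V = "verts G"
  assume "s \<otimes>\<^bsub>mpoly_ring K ?V\<^esub> poly_var v \<in> edge_ideal K G"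
  moreover have "e \<inter> (?V - {v}) \<noteq> {}" if "e \<in> edges G" for e
  proof
    assume "e \<inter> (?V - {v}) = {}"
    moreover have "e \<subseteq> ?V" "card e = 2" using assms(1) that by (auto simp: simple_graph_def)
    ultimately have "e \<subseteq> {v}" by blast
    then show False using \<open>card e = 2\<close> card_mono[of "{v}" e] by simp
  qed
  ultimately have "s \<otimes>\<^bsub>mpoly_ring K ?V\<^esub> poly_var v \<in> face_ideal K ?V (?V - {v})"
    using edge_ideal_subset_face_ideal[OF assms(1)] by blast
  moreover have "poly_var v \<in> carrier (mpoly_ring K ?V)"
    using assms(2) by (simp add: mpoly_ring_simps poly_var_def)
  ultimately have "s \<in> face_ideal K ?V (?V - {v}) \<or> poly_var v \<in> face_ideal K ?V (?V - {v})"
    using s by (intro primeideal.I_prime[OF primeideal_face_ideal]) auto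
  then have "s \<in> face_ideal K ?V (?V - {v})" by (simp add: poly_var_in_face_ideal_iff)
  moreover have "face_ideal K ?V (?V - {v}) \<subseteq> face_ideal K ?V ?V"
    by (rule monomial_ideal_mono) blast
  ultimately show False using s by blast
qed


subsection \<open>Joins of graphs\<close>

text \<open>The vertex \<open>u\<close> makes one half of the split nonzero. The non-adjacent pair
  in \<open>H\<close> does so for the other half and supplies a face with two vertices, hence
  dimension at least two.\<close>

theorem not_cohen_macaulay_graph_join:
  fixes G :: "'v ugraph" and H :: "'w ugraph"
  assumes G: "simple_graph G" "u \<in> verts G"
    and H: "simple_graph H" "y \<in> verts H" "z \<in> verts H" "y \<noteq> z" "{y, z} \<notin> edges H"
  shows "\<not> cohen_macaulay_graph TYPE('k::field) (graph_join G H)"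
proof -
  let ?K = "TYPE('k)" and ?V = "verts (graph_join G H)"
  let ?R = "mpoly_ring ?K ?V"
  define E where "E = {m. \<exists>e\<in>edges (graph_join G H). e \<subseteq> Poly_Mapping.keys (m :: 'v + 'w \<Rightarrow>\<^sub>0 nat)}"
  define T :: "('v + 'w) set \<Rightarrow> ('v + 'w \<Rightarrow>\<^sub>0 nat) set"
    where "T W = {m. Poly_Mapping.keys m \<inter> W \<noteq> {}}" for W
  have simple: "simple_graph (graph_join G H)" by (rule simple_graph_join[OF G(1) H(1)])
  have V: "?V = Inl ` verts G \<union> Inr ` verts H" by (simp add: graph_join_def)
  have I: "edge_ideal ?K (graph_join G H) = monomial_ideal ?K ?V E"
    unfolding E_def by (rule edge_ideal_eq_monomial_ideal[OF simple])
  interpret I: ideal "edge_ideal ?K (graph_join G H)" ?R by (rule ideal_edge_ideal[OF simple])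
  \<comment> \<open>The preimage in the polynomial ring of the ideal generated by the variables in
    \<open>W\<close>; adding \<open>E\<close> puts the edge ideal inside.\<close>
  define J where "J W = monomial_ideal ?K ?V (T W \<union> E)" for W
  have J: "ideal (J W) ?R" for W
    unfolding J_def by (rule ideal_monomial_ideal) (auto simp: T_def E_def keys_add_nat)
  have J_var: "poly_var v \<in> J W" if "v \<in> ?V" "v \<in> W" for v W
    using that by (auto simp: J_def monomial_ideal_def mpoly_ring_simps poly_var_def T_def)
  show ?thesis
    unfolding cohen_macaulay_graph_def
  proof (rule I.not_cohen_macaulay_quot_if_ideals_split)
    show "cring ?R" by (rule cring_mpoly_ring)
    \<comment> \<open>The faces \<open>{y, z}\<close>, \<open>{z}\<close> and the empty face shrink,
      so their primes grow up to the irrelevant ideal.\<close>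
    show "primeideal (face_ideal ?K ?V (?V - {Inr y, Inr z})) ?R"
         "primeideal (face_ideal ?K ?V (?V - {Inr z})) ?R"
      by (rule primeideal_face_ideal)+
    show "maximalideal (face_ideal ?K ?V ?V) ?R" by (rule maximalideal_face_ideal)
    have yz: "Inr y \<in> ?V" "Inr z \<in> ?V" using H by (auto simp: V)
    have "poly_var (Inr y) \<in> face_ideal ?K ?V (?V - {Inr z})"
         "poly_var (Inr y) \<notin> face_ideal ?K ?V (?V - {Inr y, Inr z})"
         "poly_var (Inr z) \<in> face_ideal ?K ?V ?V"
         "poly_var (Inr z) \<notin> face_ideal ?K ?V (?V - {Inr z})"
      using yz H(4) by (simp_all add: poly_var_in_face_ideal_iff)
    moreover have "face_ideal ?K ?V (?V - {Inr y, Inr z}) \<subseteq> face_ideal ?K ?V (?V - {Inr z})"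
      "face_ideal ?K ?V (?V - {Inr z}) \<subseteq> face_ideal ?K ?V ?V"
      by (rule monomial_ideal_mono, blast)+
    ultimately show "face_ideal ?K ?V (?V - {Inr y, Inr z}) \<subset> face_ideal ?K ?V (?V - {Inr z})"
      "face_ideal ?K ?V (?V - {Inr z}) \<subset> face_ideal ?K ?V ?V"
      by blast+
    show "edge_ideal ?K (graph_join G H) \<subseteq> face_ideal ?K ?V (?V - {Inr y, Inr z})"
    proof (rule edge_ideal_subset_face_ideal[OF simple])
      fix e assume e: "e \<in> edges (graph_join G H)"
      show "e \<inter> (?V - {Inr y, Inr z}) \<noteq> {}"
      proof
        assume "e \<inter> (?V - {Inr y, Inr z}) = {}"
        moreover have "e \<subseteq> ?V" "card e = 2" using simple e by (auto simp: simple_graph_def)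
        ultimately have "e \<subseteq> {Inr y, Inr z}" "card e = card {Inr y :: 'v + 'w, Inr z}"
          using H(4) by auto
        then have eq: "e = {Inr y, Inr z}" by (intro card_subset_eq) auto
        \<comment> \<open>Cross edges and edges from \<open>G\<close> contain an \<open>Inl\<close>
          vertex, so this edge can come only from \<open>H\<close>.\<close>
        then have "e \<in> (`) Inr ` edges H" using e by (auto simp: graph_join_def doubleton_eq_iff)
        then obtain f where f: "f \<in> edges H" "Inr ` f = (Inr ` {y, z} :: ('v + 'w) set)" using eq by auto
        then have "f = {y, z}" by (simp only: inj_image_eq_iff[OF inj_Inr])
        then show False using f H(5) by simp
      qed
    qed
    show "ideal (J (Inl ` verts G)) ?R" "ideal (J (Inr ` verts H)) ?R" by (rule J)+
    \<comment> \<open>A monomial meeting both vertex sets contains a cross edge of the join; this is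
      what makes the two ideals intersect in the edge ideal.\<close>
    have "m \<in> E" if "m \<in> T (Inl ` verts G)" "m \<in> T (Inr ` verts H)" for m
    proof -
      obtain p q where "p \<in> verts G" "q \<in> verts H" "{Inl p, Inr q} \<subseteq> Poly_Mapping.keys m"
        using \<open>m \<in> T (Inl ` verts G)\<close> \<open>m \<in> T (Inr ` verts H)\<close> unfolding T_def by blast
      moreover from this have "{Inl p, Inr q} \<in> edges (graph_join G H)"
        by (auto simp: graph_join_def)
      ultimately show ?thesis unfolding E_def by blast
    qed
    then have "(T (Inl ` verts G) \<union> E) \<inter> (T (Inr ` verts H) \<union> E) = E" by blast
    then show "J (Inl ` verts G) \<inter> J (Inr ` verts H) = edge_ideal ?K (graph_join G H)"
      by (simp add: J_def I monomial_ideal_Int)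
    have "face_ideal ?K ?V ?V \<subseteq> monomial_ideal ?K ?V ((T (Inl ` verts G) \<union> E) \<union> (T (Inr ` verts H) \<union> E))"
      by (rule monomial_ideal_mono) (auto simp: T_def V)
    then show "face_ideal ?K ?V ?V \<subseteq> J (Inl ` verts G) <+>\<^bsub>?R\<^esub> J (Inr ` verts H)"
      unfolding J_def using monomial_ideal_Un_subset_add by (rule order_trans)
    show "poly_var (Inl u) \<in> J (Inl ` verts G)" "poly_var (Inr y) \<in> J (Inr ` verts H)"
      using G H by (auto intro!: J_var simp: V)
    show "s \<otimes>\<^bsub>?R\<^esub> poly_var (Inl u) \<notin> edge_ideal ?K (graph_join G H)"
         "s \<otimes>\<^bsub>?R\<^esub> poly_var (Inr y) \<notin> edge_ideal ?K (graph_join G H)"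
      if "s \<in> carrier ?R - face_ideal ?K ?V ?V" for s
      using that G(2) H(2) by (intro times_poly_var_notin_edge_ideal[OF simple]; simp add: V)+
  qed
qed

text \<open>Every edge stays within one copy, so forgetting the copy index recovers an edge of
  \<open>G\<close>. This reduces non-adjacency inside a copy to non-adjacency in
  \<open>G\<close>.\<close>

lemma snd_image_edge_disjoint_copies: "e \<in> edges (disjoint_copies n G) \<Longrightarrow> snd ` e \<in> edges G"
  by (auto simp: disjoint_copies_def image_image)

theorem theorem6p4:
  fixes a b n :: nat
  assumes "a \<ge> 1" and "b \<ge> 2" and "n \<ge> 1"
  shows "\<not> cohen_macaulay_graph TYPE('k::field)
           (graph_join (edgeless_graph a) (disjoint_copies n (B_graph b)))"
proof (rule not_cohen_macaulay_graph_join)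
  show "simple_graph (edgeless_graph a)" by (rule simple_edgeless_graph)
  show "simple_graph (disjoint_copies n (B_graph b))"
    by (intro simple_disjoint_copies simple_B_graph)
  show "1 \<in> verts (edgeless_graph a)" using assms by (simp add: edgeless_graph_def)
  \<comment> \<open>\<open>BX 1\<close> and \<open>BY 2\<close> lie in different cliques, which are
    linked only between equal indices; \<open>b \<ge> 2\<close> supplies the index 2 and
    \<open>n \<ge> 1\<close> the copy 1.\<close>
  show "(1, BX 1) \<in> verts (disjoint_copies n (B_graph b))" "(1, BY 2) \<in> verts (disjoint_copies n (B_graph b))"
    using assms by (auto simp: disjoint_copies_def B_graph_def)
  show "{(1, BX 1), (1, BY 2)} \<notin> edges (disjoint_copies n (B_graph b))"
  proof
    assume "{(1, BX 1), (1, BY 2)} \<in> edges (disjoint_copies n (B_graph b))"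
    from snd_image_edge_disjoint_copies[OF this]
    have "{BX 1, BY 2} \<in> edges (B_graph b)" by simp
    then show False by (auto simp: B_graph_def doubleton_eq_iff)
  qed
qed simp

end
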